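(* Let $\xi\in\mathbb{R}^n$, let $(\mathbf{u},\mathbf{v})\in\mathcal{U}\times\mathcal{V}$ be an admissible control pair with corresponding state process $x$ (started at $x_0=\xi$), and let $y_1=(y_{1,k})_{k=0}^N,\ y_2=(y_{2,k})_{k=0}^N\in L^2_{\mathbb{F}}(\overline{\mathcal{T}};\mathbb{R}^n)$ be the solutions of the adjoint equations corresponding to $(x,\mathbf{u},\mathbf{v})$: for $k\in\mathcal{T}$, $$y_{1,k}=A_k^\top\mathbb{E}[y_{1,k+1}\mid\mathcal{F}_{k-1}]+D_k^\top\mathbb{E}[y_{1,k+1}\omega_k\mid\mathcal{F}_{k-1}]+Q_kx_k+L_k^\top u_k+q_k,\qquad y_{1,N}=G_Nx_N+g_N,$$ $$y_{2,k}=A_k^\top\mathbb{E}[y_{2,k+1}\mid\mathcal{F}_{k-1}]+D_k^\top\mathbb{E}[y_{2,k+1}\omega_k\mid\mathcal{F}_{k-1}]+P_kx_k+M_k^\top v_k+p_k,\qquad y_{2,N}=H_Nx_N+h_N.$$ Then $(\mathbf{u},\mathbf{v})$ is an open-loop Nash equilibrium point of the game (DTSDG) with initial state $\xi$ if and only if the stationarity conditions $\partial_uH_1(k,x,u,v,y_1)=0$ and $\partial_vH_2(k,x,u,v,y_2)=0$ hold for all $k\in\mathcal{T}$, that is, almost surely for all $k\in\mathcal{T}$, $$B_k^\top\mathbb{E}[y_{1,k+1}\mid\mathcal{F}_{k-1}]+E_k^\top\mathbb{E}[y_{1,k+1}\omega_k\mid\mathcal{F}_{k-1}]+L_kx_k+R_ku_k+\rho_k=0$$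 and $$C_k^\top\mathbb{E}[y_{2,k+1}\mid\mathcal{F}_{k-1}]+F_k^\top\mathbb{E}[y_{2,k+1}\omega_k\mid\mathcal{F}_{k-1}]+M_kx_k+S_kv_k+\theta_k=0.$$
   Context: Probability setting. $N$ is a positive integer, $\mathcal{T}=\{0,\dots,N-1\}$, $\overline{\mathcal{T}}=\{0,\dots,N\}$. On a complete probability space $(\Omega,\mathcal{F},\mathbb{P})$ let $(\omega_k)_{k\in\mathcal{T}}$ be real random variables, $\mathcal{F}_k=\sigma(\omega_0,\dots,\omega_k)$ for $k\in\mathcal{T}$ (filtration taken $\mathbb{P}$-complete), $\mathcal{F}_{-1}=\{\emptyset,\Omega\}$, with $\mathbb{E}[\omega_k\mid\mathcal{F}_{k-1}]=0$, $\mathbb{E}[\omega_k^2\mid\mathcal{F}_{k-1}]=1$, $\mathbb{E}[\omega_k^4]<\infty$ for all $k\in\mathcal T$. Spaces. For a finite-dimensional real space $E$ and $I\in\{\mathcal{T},\overline{\mathcal{T}}\}$, $L^2_{\mathbb{F}}(I;E)$ is the set of $E$-valued processes $(f_k)_{k\in I}$ with $f_k$ $\mathcal{F}_{k-1}$-measurable and $\mathbb{E}\sum_{k\in I}|f_k|^2<\infty$; $L^\infty_{\mathbb{F}}(I;E)$ is the set of essentially bounded such processes; $L^2_{\mathcal{F}_{N-1}}(\Omega;E)$, $L^\infty_{\mathcal{F}_{N-1}}(\Omega;E)$ are the square integrable, resp. essentially bounded, $\mathcal{F}_{N-1}$-measurable $E$-valued random variables. $\mathcal{U}=L^2_{\mathbb{F}}(\mathcal{T};\mathbb{R}^m)$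 and $\mathcal{V}=L^2_{\mathbb{F}}(\mathcal{T};\mathbb{R}^l)$ are the admissible controls of Players 1 and 2. State equation. For $\xi\in\mathbb{R}^n$, $\mathbf{u}\in\mathcal{U}$, $\mathbf{v}\in\mathcal{V}$: $x_0=\xi$ and, for $k\in\mathcal{T}$, $$x_{k+1}=A_kx_k+B_ku_k+C_kv_k+b_k+(D_kx_k+E_ku_k+F_kv_k+\sigma_k)\omega_k .$$ Costs. $$\mathcal{J}_1(0,\xi;\mathbf{u},\mathbf{v})=\tfrac12\mathbb{E}\Big\{\langle G_Nx_N,x_N\rangle+2\langle g_N,x_N\rangle+\sum_{k=0}^{N-1}\big[\langle Q_kx_k,x_k\rangle+2\langle L_k^\top u_k,x_k\rangle+\langle R_ku_k,u_k\rangle+2\langle q_k,x_k\rangle+2\langle\rho_k,u_k\rangle\big]\Big\},$$ $$\mathcal{J}_2(0,\xi;\mathbf{u},\mathbf{v})=\tfrac12\mathbb{E}\Big\{\langle H_Nx_N,x_N\rangle+2\langle h_N,x_N\rangle+\sum_{k=0}^{N-1}\big[\langle P_kx_k,x_k\rangle+2\langle M_k^\top v_k,x_k\rangle+\langle S_kv_k,v_k\rangle+2\langle p_k,x_k\rangle+2\langle\theta_k,v_k\rangle\big]\Big\}.$$ Assumptions on coefficients. $A,D\in L^\infty_{\mathbb{F}}(\mathcal{T};\mathbb{R}^{n\times n})$, $B,E\in L^\infty_{\mathbb{F}}(\mathcal{T};\mathbb{R}^{n\times m})$, $C,F\in L^\infty_{\mathbb{F}}(\mathcal{T};\mathbb{R}^{n\times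 l})$, $b,\sigma\in L^2_{\mathbb{F}}(\mathcal{T};\mathbb{R}^n)$; $Q,P\in L^\infty_{\mathbb{F}}(\mathcal{T};\mathbb{R}^{n\times n})$, $L\in L^\infty_{\mathbb{F}}(\mathcal{T};\mathbb{R}^{m\times n})$, $M\in L^\infty_{\mathbb{F}}(\mathcal{T};\mathbb{R}^{l\times n})$, $R\in L^\infty_{\mathbb{F}}(\mathcal{T};\mathbb{R}^{m\times m})$, $S\in L^\infty_{\mathbb{F}}(\mathcal{T};\mathbb{R}^{l\times l})$, $G_N,H_N\in L^\infty_{\mathcal{F}_{N-1}}(\Omega;\mathbb{R}^{n\times n})$, $g_N,h_N\in L^2_{\mathcal{F}_{N-1}}(\Omega;\mathbb{R}^n)$, $q,p\in L^2_{\mathbb{F}}(\mathcal{T};\mathbb{R}^n)$, $\rho\in L^2_{\mathbb{F}}(\mathcal{T};\mathbb{R}^m)$, $\theta\in L^2_{\mathbb{F}}(\mathcal{T};\mathbb{R}^l)$. The matrices $Q_k,P_k,R_k,S_k,G_N,H_N$ are symmetric, and there is a constant $\delta>0$ such that, almost surely for all $k\in\mathcal{T}$: $G_N,H_N\succeq0$, $R_k,S_k\succeq\delta I$, $Q_k-L_k^\top R_k^{-1}L_k\succeq0$, $P_k-M_k^\top S_k^{-1}M_k\succeq0$. Nash equilibrium. $(\mathbf{u}^*,\mathbf{v}^* )\in\mathcal{U}\times\mathcal{V}$ is an open-loop Nash equilibrium point of (DTSDG) for the initial state $\xi$ if $\mathcal{J}_1(0,\xi;\mathbf{u}^*,\mathbf{v}^*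 )=\inf_{\mathbf{u}\in\mathcal{U}}\mathcal{J}_1(0,\xi;\mathbf{u},\mathbf{v}^* )$ and $\mathcal{J}_2(0,\xi;\mathbf{u}^*,\mathbf{v}^* )=\inf_{\mathbf{v}\in\mathcal{V}}\mathcal{J}_2(0,\xi;\mathbf{u}^*,\mathbf{v})$. Hamiltonians. For $k\in\mathcal{T}$, $$H_1(k,x,u,v,y_1)=\mathbb{E}\big[\langle y_{1,k+1},A_kx_k+B_ku_k+C_kv_k\rangle+\langle y_{1,k+1}\omega_k,D_kx_k+E_ku_k+F_kv_k\rangle\mid\mathcal{F}_{k-1}\big]+\tfrac12\langle Q_kx_k,x_k\rangle+\tfrac12\langle R_ku_k,u_k\rangle+\langle L_k^\top u_k,x_k\rangle+\langle q_k,x_k\rangle+\langle\rho_k,u_k\rangle,$$ $$H_2(k,x,u,v,y_2)=\mathbb{E}\big[\langle y_{2,k+1},A_kx_k+B_ku_k+C_kv_k\rangle+\langle y_{2,k+1}\omega_k,D_kx_k+E_ku_k+F_kv_k\rangle\mid\mathcal{F}_{k-1}\big]+\tfrac12\langle P_kx_k,x_k\rangle+\tfrac12\langle S_kv_k,v_k\rangle+\langle M_k^\top v_k,x_k\rangle+\langle p_k,x_k\rangle+\langle\theta_k,v_k\rangle.$$ $\partial_uH_1$ and $\partial_vH_2$ are the partial derivatives with respect to the $\mathcal{F}_{k-1}$-measurable variables $u_k$ and $v_k$, respectively, with the $y_i$ held fixed. *)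

theory Defs
  imports "HOL-Probability.Probability"
begin

section \<open>Square integrable and essentially bounded random variables\<close>

text \<open>Almost surely equal random variables are not identified.\<close>

definition L2_rv :: "'a measure \<Rightarrow> 'a measure \<Rightarrow> ('a \<Rightarrow> 'e::euclidean_space) set" where
  "L2_rv M F = {f \<in> borel_measurable F. integrable M (\<lambda>w. (norm (f w))\<^sup>2)}"

definition Linf_rv :: "'a measure \<Rightarrow> 'a measure \<Rightarrow> ('a \<Rightarrow> 'e::euclidean_space) set" where
  "Linf_rv M F = {f \<in> borel_measurable F. \<exists>c. AE w in M. norm (f w) \<le> c}"

definition vec_cond_exp ::
  "'a measure \<Rightarrow> 'a measure \<Rightarrow> ('a \<Rightarrow> real ^ 'n) \<Rightarrow> 'a \<Rightarrow> real ^ 'n" where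
  "vec_cond_exp M F f = (\<lambda>w. \<chi> i. real_cond_exp M F (\<lambda>w'. f w' $ i) w)"

definition psd :: "real ^ 'n ^ 'n \<Rightarrow> bool" where
  "psd A \<longleftrightarrow> (\<forall>x. 0 \<le> (A *v x) \<bullet> x)"

text \<open>\<open>has_rv_gradient M F \<Phi> r Z\<close>: the random functional \<open>\<Phi>\<close> of an \<open>F\<close>-measurable variable has
  at \<open>r\<close> the gradient \<open>Z\<close>, itself \<open>F\<close>-measurable.  \<open>\<Phi>\<close> may involve a conditional expectation, so
  its values are determined only up to null sets depending on the argument, and differentiating for
  fixed \<open>w\<close> makes no sense. Difference quotients in every direction \<open>\<eta>\<close> are therefore required to
  converge to \<open>Z \<bullet> \<eta>\<close> in \<open>L\<^sup>1(M)\<close>. The \<open>L\<^sup>1\<close> distance is a nonnegative integral, hence infinite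
  (and not \<open>0\<close>) when the difference is not integrable.\<close>

definition has_rv_gradient ::
  "'a measure \<Rightarrow> 'a measure \<Rightarrow> (('a \<Rightarrow> 'e) \<Rightarrow> 'a \<Rightarrow> real) \<Rightarrow> ('a \<Rightarrow> 'e)
    \<Rightarrow> ('a \<Rightarrow> 'e::euclidean_space) \<Rightarrow> bool" where
  "has_rv_gradient M F \<Phi> r Z \<longleftrightarrow>
     Z \<in> L2_rv M F \<and>
     (\<forall>\<eta> \<in> L2_rv M F.
        ((\<lambda>\<epsilon>::real. \<integral>\<^sup>+ w. ennreal \<bar>(\<Phi> (\<lambda>w'. r w' + \<epsilon> *\<^sub>R \<eta> w') w - \<Phi> r w) / \<epsilon> - Z w \<bullet> \<eta> w\<bar> \<partial>M)
           \<longlongrightarrow> 0) (at 0))"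


section \<open>The two-player linear-quadratic game\<close>

text \<open>The field \<open>coef_X\<close> is the coefficient process written \<open>X\<close> on paper. The terminal data
  \<open>G\<^sub>N, g\<^sub>N, H\<^sub>N, h\<^sub>N\<close> are the random variables \<open>term_G, term_g, term_H, term_h\<close>.\<close>

record ('a, 'n, 'm, 'l) lq_game =
  pspace :: "'a measure"
  horizon :: nat
  noise :: "nat \<Rightarrow> 'a \<Rightarrow> real"
  coef_A :: "nat \<Rightarrow> 'a \<Rightarrow> real ^ 'n ^ 'n"
  coef_B :: "nat \<Rightarrow> 'a \<Rightarrow> real ^ 'm ^ 'n"
  coef_C :: "nat \<Rightarrow> 'a \<Rightarrow> real ^ 'l ^ 'n"
  coef_b :: "nat \<Rightarrow> 'a \<Rightarrow> real ^ 'n"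
  coef_D :: "nat \<Rightarrow> 'a \<Rightarrow> real ^ 'n ^ 'n"
  coef_E :: "nat \<Rightarrow> 'a \<Rightarrow> real ^ 'm ^ 'n"
  coef_F :: "nat \<Rightarrow> 'a \<Rightarrow> real ^ 'l ^ 'n"
  coef_sigma :: "nat \<Rightarrow> 'a \<Rightarrow> real ^ 'n"
  coef_Q :: "nat \<Rightarrow> 'a \<Rightarrow> real ^ 'n ^ 'n"
  coef_L :: "nat \<Rightarrow> 'a \<Rightarrow> real ^ 'n ^ 'm"
  coef_R :: "nat \<Rightarrow> 'a \<Rightarrow> real ^ 'm ^ 'm"
  coef_q :: "nat \<Rightarrow> 'a \<Rightarrow> real ^ 'n"
  coef_rho :: "nat \<Rightarrow> 'a \<Rightarrow> real ^ 'm"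
  term_G :: "'a \<Rightarrow> real ^ 'n ^ 'n"
  term_g :: "'a \<Rightarrow> real ^ 'n"
  coef_P :: "nat \<Rightarrow> 'a \<Rightarrow> real ^ 'n ^ 'n"
  coef_M :: "nat \<Rightarrow> 'a \<Rightarrow> real ^ 'n ^ 'l"
  coef_S :: "nat \<Rightarrow> 'a \<Rightarrow> real ^ 'l ^ 'l"
  coef_p :: "nat \<Rightarrow> 'a \<Rightarrow> real ^ 'n"
  coef_theta :: "nat \<Rightarrow> 'a \<Rightarrow> real ^ 'l"
  term_H :: "'a \<Rightarrow> real ^ 'n ^ 'n"
  term_h :: "'a \<Rightarrow> real ^ 'n"

text \<open>Index shift: \<open>past \<Gamma> k\<close> is \<open>\<F>\<^sub>k\<^sub>-\<^sub>1\<close>. For \<open>k > 0\<close> it is generated by the noise before time \<open>k\<close>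
  and the null sets; \<open>\<F>\<^sub>-\<^sub>1\<close> is the trivial \<open>\<sigma>\<close>-algebra, not completed.\<close>

definition past :: "('a, 'n::finite, 'm::finite, 'l::finite) lq_game \<Rightarrow> nat \<Rightarrow> 'a measure" where
  "past \<Gamma> k =
     (if k = 0 then sigma (space (pspace \<Gamma>)) {}
      else sigma (space (pspace \<Gamma>))
             ({noise \<Gamma> i -` X \<inter> space (pspace \<Gamma>) | i X. i < k \<and> X \<in> sets borel}
              \<union> null_sets (pspace \<Gamma>)))"

definition L2_proc ::
  "('a, 'n::finite, 'm::finite, 'l::finite) lq_game \<Rightarrow> nat set
    \<Rightarrow> (nat \<Rightarrow> 'a \<Rightarrow> 'e::euclidean_space) set" where
  "L2_proc \<Gamma> I =
     {f. (\<forall>k\<in>I. f k \<in> borel_measurable (past \<Gamma> k)) \<and>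
         integrable (pspace \<Gamma>) (\<lambda>w. \<Sum>k\<in>I. (norm (f k w))\<^sup>2)}"

definition Linf_proc ::
  "('a, 'n::finite, 'm::finite, 'l::finite) lq_game \<Rightarrow> nat set
    \<Rightarrow> (nat \<Rightarrow> 'a \<Rightarrow> 'e::euclidean_space) set" where
  "Linf_proc \<Gamma> I =
     {f. (\<forall>k\<in>I. f k \<in> borel_measurable (past \<Gamma> k)) \<and>
         (\<exists>c. AE w in pspace \<Gamma>. \<forall>k\<in>I. norm (f k w) \<le> c)}"

abbreviation stages :: "('a, 'n::finite, 'm::finite, 'l::finite) lq_game \<Rightarrow> nat set" where
  "stages \<Gamma> \<equiv> {..<horizon \<Gamma>}"

definition controls1 ::
  "('a, 'n::finite, 'm::finite, 'l::finite) lq_game \<Rightarrow> (nat \<Rightarrow> 'a \<Rightarrow> real ^ 'm) set" where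
  "controls1 \<Gamma> = L2_proc \<Gamma> (stages \<Gamma>)"

definition controls2 ::
  "('a, 'n::finite, 'm::finite, 'l::finite) lq_game \<Rightarrow> (nat \<Rightarrow> 'a \<Rightarrow> real ^ 'l) set" where
  "controls2 \<Gamma> = L2_proc \<Gamma> (stages \<Gamma>)"


subsection \<open>Standing assumptions\<close>

definition noise_assumptions ::
  "('a, 'n::finite, 'm::finite, 'l::finite) lq_game \<Rightarrow> bool" where
  "noise_assumptions \<Gamma> \<longleftrightarrow>
     prob_space (pspace \<Gamma>) \<and> complete_measure (pspace \<Gamma>) \<and> horizon \<Gamma> > 0 \<and>
     (\<forall>k\<in>stages \<Gamma>.
        noise \<Gamma> k \<in> borel_measurable (pspace \<Gamma>) \<and>
        integrable (pspace \<Gamma>) (\<lambda>w. noise \<Gamma> k w ^ 4) \<and>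
        (AE w in pspace \<Gamma>. real_cond_exp (pspace \<Gamma>) (past \<Gamma> k) (noise \<Gamma> k) w = 0) \<and>
        (AE w in pspace \<Gamma>.
           real_cond_exp (pspace \<Gamma>) (past \<Gamma> k) (\<lambda>w'. (noise \<Gamma> k w')\<^sup>2) w = 1))"

definition coefficient_assumptions ::
  "('a, 'n::finite, 'm::finite, 'l::finite) lq_game \<Rightarrow> bool" where
  "coefficient_assumptions \<Gamma> \<longleftrightarrow>
     coef_A \<Gamma> \<in> Linf_proc \<Gamma> (stages \<Gamma>) \<and> coef_D \<Gamma> \<in> Linf_proc \<Gamma> (stages \<Gamma>) \<and>
     coef_B \<Gamma> \<in> Linf_proc \<Gamma> (stages \<Gamma>) \<and> coef_E \<Gamma> \<in> Linf_proc \<Gamma> (stages \<Gamma>) \<and>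
     coef_C \<Gamma> \<in> Linf_proc \<Gamma> (stages \<Gamma>) \<and> coef_F \<Gamma> \<in> Linf_proc \<Gamma> (stages \<Gamma>) \<and>
     coef_b \<Gamma> \<in> L2_proc \<Gamma> (stages \<Gamma>) \<and> coef_sigma \<Gamma> \<in> L2_proc \<Gamma> (stages \<Gamma>) \<and>
     coef_Q \<Gamma> \<in> Linf_proc \<Gamma> (stages \<Gamma>) \<and> coef_P \<Gamma> \<in> Linf_proc \<Gamma> (stages \<Gamma>) \<and>
     coef_L \<Gamma> \<in> Linf_proc \<Gamma> (stages \<Gamma>) \<and> coef_M \<Gamma> \<in> Linf_proc \<Gamma> (stages \<Gamma>) \<and>
     coef_R \<Gamma> \<in> Linf_proc \<Gamma> (stages \<Gamma>) \<and> coef_S \<Gamma> \<in> Linf_proc \<Gamma> (stages \<Gamma>) \<and>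
     term_G \<Gamma> \<in> Linf_rv (pspace \<Gamma>) (past \<Gamma> (horizon \<Gamma>)) \<and>
     term_H \<Gamma> \<in> Linf_rv (pspace \<Gamma>) (past \<Gamma> (horizon \<Gamma>)) \<and>
     term_g \<Gamma> \<in> L2_rv (pspace \<Gamma>) (past \<Gamma> (horizon \<Gamma>)) \<and>
     term_h \<Gamma> \<in> L2_rv (pspace \<Gamma>) (past \<Gamma> (horizon \<Gamma>)) \<and>
     coef_q \<Gamma> \<in> L2_proc \<Gamma> (stages \<Gamma>) \<and> coef_p \<Gamma> \<in> L2_proc \<Gamma> (stages \<Gamma>) \<and>
     coef_rho \<Gamma> \<in> L2_proc \<Gamma> (stages \<Gamma>) \<and> coef_theta \<Gamma> \<in> L2_proc \<Gamma> (stages \<Gamma>)"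

definition convexity_assumptions ::
  "('a, 'n::finite, 'm::finite, 'l::finite) lq_game \<Rightarrow> bool" where
  "convexity_assumptions \<Gamma> \<longleftrightarrow>
     (AE w in pspace \<Gamma>.
        transpose (term_G \<Gamma> w) = term_G \<Gamma> w \<and> transpose (term_H \<Gamma> w) = term_H \<Gamma> w \<and>
        (\<forall>k\<in>stages \<Gamma>.
           transpose (coef_Q \<Gamma> k w) = coef_Q \<Gamma> k w \<and> transpose (coef_P \<Gamma> k w) = coef_P \<Gamma> k w \<and>
           transpose (coef_R \<Gamma> k w) = coef_R \<Gamma> k w \<and> transpose (coef_S \<Gamma> k w) = coef_S \<Gamma> k w)) \<and>
     (\<exists>\<delta>>0. AE w in pspace \<Gamma>.
        psd (term_G \<Gamma> w) \<and> psd (term_H \<Gamma> w) \<and>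
        (\<forall>k\<in>stages \<Gamma>.
           psd (coef_R \<Gamma> k w - mat \<delta>) \<and> psd (coef_S \<Gamma> k w - mat \<delta>) \<and>
           psd (coef_Q \<Gamma> k w
                - transpose (coef_L \<Gamma> k w) ** matrix_inv (coef_R \<Gamma> k w) ** coef_L \<Gamma> k w) \<and>
           psd (coef_P \<Gamma> k w
                - transpose (coef_M \<Gamma> k w) ** matrix_inv (coef_S \<Gamma> k w) ** coef_M \<Gamma> k w)))"


subsection \<open>State, costs and equilibria\<close>

primrec lq_state ::
  "('a, 'n::finite, 'm::finite, 'l::finite) lq_game \<Rightarrow> real ^ 'n
    \<Rightarrow> (nat \<Rightarrow> 'a \<Rightarrow> real ^ 'm) \<Rightarrow> (nat \<Rightarrow> 'a \<Rightarrow> real ^ 'l) \<Rightarrow> nat \<Rightarrow> 'a \<Rightarrow> real ^ 'n" where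
  "lq_state \<Gamma> \<xi> u v 0 = (\<lambda>w. \<xi>)"
| "lq_state \<Gamma> \<xi> u v (Suc k) = (\<lambda>w.
     coef_A \<Gamma> k w *v lq_state \<Gamma> \<xi> u v k w + coef_B \<Gamma> k w *v u k w + coef_C \<Gamma> k w *v v k w
       + coef_b \<Gamma> k w
     + noise \<Gamma> k w *\<^sub>R
         (coef_D \<Gamma> k w *v lq_state \<Gamma> \<xi> u v k w + coef_E \<Gamma> k w *v u k w + coef_F \<Gamma> k w *v v k w
            + coef_sigma \<Gamma> k w))"

definition cost1 ::
  "('a, 'n::finite, 'm::finite, 'l::finite) lq_game \<Rightarrow> real ^ 'n
    \<Rightarrow> (nat \<Rightarrow> 'a \<Rightarrow> real ^ 'm) \<Rightarrow> (nat \<Rightarrow> 'a \<Rightarrow> real ^ 'l) \<Rightarrow> real" where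
  "cost1 \<Gamma> \<xi> u v =
    (let x = lq_state \<Gamma> \<xi> u v; N = horizon \<Gamma> in
     1/2 * (\<integral>w.
       (term_G \<Gamma> w *v x N w) \<bullet> x N w + 2 * (term_g \<Gamma> w \<bullet> x N w)
       + (\<Sum>k<N. (coef_Q \<Gamma> k w *v x k w) \<bullet> x k w
            + 2 * ((transpose (coef_L \<Gamma> k w) *v u k w) \<bullet> x k w)
            + (coef_R \<Gamma> k w *v u k w) \<bullet> u k w
            + 2 * (coef_q \<Gamma> k w \<bullet> x k w) + 2 * (coef_rho \<Gamma> k w \<bullet> u k w)) \<partial>pspace \<Gamma>))"

definition cost2 ::
  "('a, 'n::finite, 'm::finite, 'l::finite) lq_game \<Rightarrow> real ^ 'n
    \<Rightarrow> (nat \<Rightarrow> 'a \<Rightarrow> real ^ 'm) \<Rightarrow> (nat \<Rightarrow> 'a \<Rightarrow> real ^ 'l) \<Rightarrow> real" where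
  "cost2 \<Gamma> \<xi> u v =
    (let x = lq_state \<Gamma> \<xi> u v; N = horizon \<Gamma> in
     1/2 * (\<integral>w.
       (term_H \<Gamma> w *v x N w) \<bullet> x N w + 2 * (term_h \<Gamma> w \<bullet> x N w)
       + (\<Sum>k<N. (coef_P \<Gamma> k w *v x k w) \<bullet> x k w
            + 2 * ((transpose (coef_M \<Gamma> k w) *v v k w) \<bullet> x k w)
            + (coef_S \<Gamma> k w *v v k w) \<bullet> v k w
            + 2 * (coef_p \<Gamma> k w \<bullet> x k w) + 2 * (coef_theta \<Gamma> k w \<bullet> v k w)) \<partial>pspace \<Gamma>))"

text \<open>The infima are taken in \<open>ereal\<close>, since the real \<open>Inf\<close> is meaningless on sets that are not
  bounded below.\<close>

definition open_loop_nash ::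
  "('a, 'n::finite, 'm::finite, 'l::finite) lq_game \<Rightarrow> real ^ 'n
    \<Rightarrow> (nat \<Rightarrow> 'a \<Rightarrow> real ^ 'm) \<Rightarrow> (nat \<Rightarrow> 'a \<Rightarrow> real ^ 'l) \<Rightarrow> bool" where
  "open_loop_nash \<Gamma> \<xi> u v \<longleftrightarrow>
     u \<in> controls1 \<Gamma> \<and> v \<in> controls2 \<Gamma> \<and>
     ereal (cost1 \<Gamma> \<xi> u v) = (INF u' \<in> controls1 \<Gamma>. ereal (cost1 \<Gamma> \<xi> u' v)) \<and>
     ereal (cost2 \<Gamma> \<xi> u v) = (INF v' \<in> controls2 \<Gamma>. ereal (cost2 \<Gamma> \<xi> u v'))"


subsection \<open>Adjoint equations and Hamiltonians\<close>

text \<open>\<open>adj_mean \<Gamma> y k\<close> is \<open>\<E>[y\<^sub>k\<^sub>+\<^sub>1 | \<F>\<^sub>k\<^sub>-\<^sub>1]\<close> and \<open>adj_noise \<Gamma> y k\<close> is \<open>\<E>[y\<^sub>k\<^sub>+\<^sub>1 \<omega>\<^sub>k | \<F>\<^sub>k\<^sub>-\<^sub>1]\<close>.\<close>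

definition adj_mean ::
  "('a, 'n::finite, 'm::finite, 'l::finite) lq_game \<Rightarrow> (nat \<Rightarrow> 'a \<Rightarrow> real ^ 'n)
    \<Rightarrow> nat \<Rightarrow> 'a \<Rightarrow> real ^ 'n" where
  "adj_mean \<Gamma> y k = vec_cond_exp (pspace \<Gamma>) (past \<Gamma> k) (y (Suc k))"

definition adj_noise ::
  "('a, 'n::finite, 'm::finite, 'l::finite) lq_game \<Rightarrow> (nat \<Rightarrow> 'a \<Rightarrow> real ^ 'n)
    \<Rightarrow> nat \<Rightarrow> 'a \<Rightarrow> real ^ 'n" where
  "adj_noise \<Gamma> y k =
     vec_cond_exp (pspace \<Gamma>) (past \<Gamma> k) (\<lambda>w. noise \<Gamma> k w *\<^sub>R y (Suc k) w)"

definition adjoint1 ::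
  "('a, 'n::finite, 'm::finite, 'l::finite) lq_game \<Rightarrow> (nat \<Rightarrow> 'a \<Rightarrow> real ^ 'n)
    \<Rightarrow> (nat \<Rightarrow> 'a \<Rightarrow> real ^ 'm) \<Rightarrow> (nat \<Rightarrow> 'a \<Rightarrow> real ^ 'n) \<Rightarrow> bool" where
  "adjoint1 \<Gamma> x u y \<longleftrightarrow>
     y \<in> L2_proc \<Gamma> {..horizon \<Gamma>} \<and>
     (AE w in pspace \<Gamma>.
        y (horizon \<Gamma>) w = term_G \<Gamma> w *v x (horizon \<Gamma>) w + term_g \<Gamma> w \<and>
        (\<forall>k\<in>stages \<Gamma>.
           y k w = transpose (coef_A \<Gamma> k w) *v adj_mean \<Gamma> y k w
                   + transpose (coef_D \<Gamma> k w) *v adj_noise \<Gamma> y k w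
                   + coef_Q \<Gamma> k w *v x k w + transpose (coef_L \<Gamma> k w) *v u k w + coef_q \<Gamma> k w))"

definition adjoint2 ::
  "('a, 'n::finite, 'm::finite, 'l::finite) lq_game \<Rightarrow> (nat \<Rightarrow> 'a \<Rightarrow> real ^ 'n)
    \<Rightarrow> (nat \<Rightarrow> 'a \<Rightarrow> real ^ 'l) \<Rightarrow> (nat \<Rightarrow> 'a \<Rightarrow> real ^ 'n) \<Rightarrow> bool" where
  "adjoint2 \<Gamma> x v y \<longleftrightarrow>
     y \<in> L2_proc \<Gamma> {..horizon \<Gamma>} \<and>
     (AE w in pspace \<Gamma>.
        y (horizon \<Gamma>) w = term_H \<Gamma> w *v x (horizon \<Gamma>) w + term_h \<Gamma> w \<and>
        (\<forall>k\<in>stages \<Gamma>.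
           y k w = transpose (coef_A \<Gamma> k w) *v adj_mean \<Gamma> y k w
                   + transpose (coef_D \<Gamma> k w) *v adj_noise \<Gamma> y k w
                   + coef_P \<Gamma> k w *v x k w + transpose (coef_M \<Gamma> k w) *v v k w + coef_p \<Gamma> k w))"

text \<open>In the Hamiltonians \<open>x\<close>, \<open>u\<close>, \<open>v\<close> are the random variables at time \<open>k\<close>, whereas \<open>y\<close> is the
  whole adjoint process.\<close>

definition hamiltonian1 ::
  "('a, 'n::finite, 'm::finite, 'l::finite) lq_game \<Rightarrow> nat \<Rightarrow> ('a \<Rightarrow> real ^ 'n)
    \<Rightarrow> ('a \<Rightarrow> real ^ 'm) \<Rightarrow> ('a \<Rightarrow> real ^ 'l) \<Rightarrow> (nat \<Rightarrow> 'a \<Rightarrow> real ^ 'n) \<Rightarrow> 'a \<Rightarrow> real" where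
  "hamiltonian1 \<Gamma> k x u v y = (\<lambda>w.
     real_cond_exp (pspace \<Gamma>) (past \<Gamma> k) (\<lambda>w'.
       y (Suc k) w' \<bullet> (coef_A \<Gamma> k w' *v x w' + coef_B \<Gamma> k w' *v u w' + coef_C \<Gamma> k w' *v v w')
       + (noise \<Gamma> k w' *\<^sub>R y (Suc k) w')
           \<bullet> (coef_D \<Gamma> k w' *v x w' + coef_E \<Gamma> k w' *v u w' + coef_F \<Gamma> k w' *v v w')) w
     + 1/2 * ((coef_Q \<Gamma> k w *v x w) \<bullet> x w) + 1/2 * ((coef_R \<Gamma> k w *v u w) \<bullet> u w)
     + (transpose (coef_L \<Gamma> k w) *v u w) \<bullet> x w + coef_q \<Gamma> k w \<bullet> x w + coef_rho \<Gamma> k w \<bullet> u w)"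

definition hamiltonian2 ::
  "('a, 'n::finite, 'm::finite, 'l::finite) lq_game \<Rightarrow> nat \<Rightarrow> ('a \<Rightarrow> real ^ 'n)
    \<Rightarrow> ('a \<Rightarrow> real ^ 'm) \<Rightarrow> ('a \<Rightarrow> real ^ 'l) \<Rightarrow> (nat \<Rightarrow> 'a \<Rightarrow> real ^ 'n) \<Rightarrow> 'a \<Rightarrow> real" where
  "hamiltonian2 \<Gamma> k x u v y = (\<lambda>w.
     real_cond_exp (pspace \<Gamma>) (past \<Gamma> k) (\<lambda>w'.
       y (Suc k) w' \<bullet> (coef_A \<Gamma> k w' *v x w' + coef_B \<Gamma> k w' *v u w' + coef_C \<Gamma> k w' *v v w')
       + (noise \<Gamma> k w' *\<^sub>R y (Suc k) w')
           \<bullet> (coef_D \<Gamma> k w' *v x w' + coef_E \<Gamma> k w' *v u w' + coef_F \<Gamma> k w' *v v w')) w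
     + 1/2 * ((coef_P \<Gamma> k w *v x w) \<bullet> x w) + 1/2 * ((coef_S \<Gamma> k w *v v w) \<bullet> v w)
     + (transpose (coef_M \<Gamma> k w) *v v w) \<bullet> x w + coef_p \<Gamma> k w \<bullet> x w + coef_theta \<Gamma> k w \<bullet> v w)"

text \<open>\<open>partial_u_H1 \<Gamma> k x u v y Z\<close> says that \<open>\<partial>\<^sub>u H\<^sub>1(k, x, u, v, y) = Z\<close>; likewise for
  \<open>\<partial>\<^sub>v H\<^sub>2\<close>.\<close>

definition partial_u_H1 ::
  "('a, 'n::finite, 'm::finite, 'l::finite) lq_game \<Rightarrow> nat \<Rightarrow> (nat \<Rightarrow> 'a \<Rightarrow> real ^ 'n)
    \<Rightarrow> (nat \<Rightarrow> 'a \<Rightarrow> real ^ 'm) \<Rightarrow> (nat \<Rightarrow> 'a \<Rightarrow> real ^ 'l) \<Rightarrow> (nat \<Rightarrow> 'a \<Rightarrow> real ^ 'n)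
    \<Rightarrow> ('a \<Rightarrow> real ^ 'm) \<Rightarrow> bool" where
  "partial_u_H1 \<Gamma> k x u v y Z \<longleftrightarrow>
     has_rv_gradient (pspace \<Gamma>) (past \<Gamma> k) (\<lambda>r. hamiltonian1 \<Gamma> k (x k) r (v k) y) (u k) Z"

definition partial_v_H2 ::
  "('a, 'n::finite, 'm::finite, 'l::finite) lq_game \<Rightarrow> nat \<Rightarrow> (nat \<Rightarrow> 'a \<Rightarrow> real ^ 'n)
    \<Rightarrow> (nat \<Rightarrow> 'a \<Rightarrow> real ^ 'm) \<Rightarrow> (nat \<Rightarrow> 'a \<Rightarrow> real ^ 'l) \<Rightarrow> (nat \<Rightarrow> 'a \<Rightarrow> real ^ 'n)
    \<Rightarrow> ('a \<Rightarrow> real ^ 'l) \<Rightarrow> bool" where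
  "partial_v_H2 \<Gamma> k x u v y Z \<longleftrightarrow>
     has_rv_gradient (pspace \<Gamma>) (past \<Gamma> k) (\<lambda>r. hamiltonian2 \<Gamma> k (x k) (u k) r y) (v k) Z"

end

theory Submission
  imports Defs
begin

text \<open>
  Fix Player 2's control \<open>v\<close>. The state is affine in Player 1's control \<open>u\<close>; its derivative in a
  direction \<open>\<eta>\<close> is the process \<open>z\<close> of \<open>lq_variation\<close>, which starts at \<open>0\<close> and solves the homogeneous
  state equation with control \<open>\<eta>\<close>. The cost at \<open>u + \<epsilon> \<eta>\<close> is therefore a quadratic polynomial in \<open>\<epsilon>\<close>
  (\<open>cost1_expansion\<close>).

  Its linear coefficient is computed by duality (\<open>adjoint_duality\<close>): summing the increments of
  \<open>\<E>\<langle>y\<^sub>k, z\<^sub>k\<rangle>\<close> over \<open>k\<close>, the adjoint equation cancels every term containing \<open>z\<close> and leaves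
  \<open>\<Sum>\<^sub>k \<E>\<langle>\<Psi>\<^sub>k, \<eta>\<^sub>k\<rangle>\<close>, where \<open>\<Psi>\<^sub>k\<close> is the left-hand side of the stationarity condition. Its quadratic
  coefficient is nonnegative, because by the Schur complement assumption the stage costs are positive
  semidefinite in state and control jointly (\<open>block_form_nonneg\<close>). Hence \<open>u\<close> is a best response to
  \<open>v\<close> if and only if \<open>\<E>\<langle>\<Psi>\<^sub>k, \<eta>\<^sub>k\<rangle>\<close> vanishes for all \<open>k\<close> and all admissible \<open>\<eta>\<^sub>k\<close>, that is,
  \<open>\<Psi>\<^sub>k = 0\<close> almost surely (\<open>best_response_iff_stationary\<close>).

  On the side of the Hamiltonian, pulling measurable factors out of the conditional expectation turns
  its difference quotient in the direction \<open>\<eta>\<close> into \<open>\<langle>\<Psi>\<^sub>k, \<eta>\<rangle> + \<epsilon> \<langle>R\<^sub>k \<eta>, \<eta>\<rangle> / 2\<close>, whose \<open>L\<^sup>1\<close> limit is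
  \<open>\<langle>\<Psi>\<^sub>k, \<eta>\<rangle>\<close>. So the gradient vanishes if and only if \<open>\<Psi>\<^sub>k = 0\<close> almost surely
  (\<open>partial_u_H1_zero_iff\<close>).

  Both characterisations hold for Player 2 as well, by applying them to the game in which the players
  have exchanged their roles.
\<close>

section \<open>Quadratic forms\<close>

lemma norm_matrix_vector_mult_le:
  fixes A :: "real ^ 'n ^ 'm"
  shows "norm (A *v x) \<le> norm A * norm x"
proof -
  have "norm (A *v x) = L2_set (\<lambda>i. norm ((A *v x) $ i)) UNIV"
    by (simp add: norm_vec_def)
  also have "\<dots> \<le> L2_set (\<lambda>i. norm (A $ i) * norm x) UNIV"
    by (intro L2_set_mono) (auto simp: matrix_vector_mul_component Cauchy_Schwarz_ineq2)
  also have "\<dots> = norm A * norm x"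
    by (simp add: norm_vec_def[of A] L2_set_left_distrib)
  finally show ?thesis .
qed

lemma norm_transpose:
  fixes A :: "real ^ 'n ^ 'm"
  shows "norm (transpose A) = norm A"
proof -
  have "(norm (transpose A))\<^sup>2 = (norm A)\<^sup>2"
    unfolding power2_norm_eq_inner inner_vec_def transpose_def vec_lambda_beta
    by (rule sum.swap)
  then show ?thesis by simp
qed

lemma inner_transpose_matrix:
  fixes A :: "real ^ 'n ^ 'm"
  shows "(transpose A *v x) \<bullet> y = x \<bullet> (A *v y)"
  by (simp add: dot_lmul_matrix)

lemma inner_symmetric_matrix:
  fixes A :: "real ^ 'n ^ 'n"
  assumes "transpose A = A"
  shows "(A *v x) \<bullet> y = (A *v y) \<bullet> x"
  by (metis assms inner_commute inner_transpose_matrix)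

lemma quadratic_form_add:
  fixes A :: "real ^ 'n ^ 'n"
  assumes "transpose A = A"
  shows "(A *v (x + e *\<^sub>R z)) \<bullet> (x + e *\<^sub>R z)
           = (A *v x) \<bullet> x + 2 * e * ((A *v x) \<bullet> z) + e\<^sup>2 * ((A *v z) \<bullet> z)"
  using inner_symmetric_matrix[OF assms, of z x]
  by (simp add: matrix_vector_right_distrib matrix_vector_mult_scaleR inner_add_left inner_add_right
      power2_eq_square algebra_simps)

lemma mat_mult_vector: "mat d *v x = d *\<^sub>R (x :: real ^ 'n)"
  by (simp add: vec_eq_iff matrix_vector_mult_def mat_def if_distrib[of "\<lambda>t. t * _"] cong: if_cong)

text \<open>Completing the square: with \<open>c = R\<inverse> L z\<close> the block form is the Schur complement at \<open>z\<close> plus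
  \<open>\<langle>R (h + c), h + c\<rangle>\<close>.\<close>

lemma block_form_nonneg:
  fixes Q :: "real ^ 'n ^ 'n" and R :: "real ^ 'm ^ 'm" and L :: "real ^ 'n ^ 'm"
  assumes "d > 0" and R: "psd (R - mat d)" and sym: "transpose R = R"
    and schur: "psd (Q - transpose L ** matrix_inv R ** L)"
  shows "0 \<le> (Q *v z) \<bullet> z + 2 * ((transpose L *v h) \<bullet> z) + (R *v h) \<bullet> h"
proof -
  have coercive: "d * (h \<bullet> h) \<le> (R *v h) \<bullet> h" for h
    using R by (auto simp: psd_def matrix_vector_mult_diff_rdistrib mat_mult_vector inner_diff_left)
  have "h = 0" if "R *v h = 0" for h
  proof -
    have "d * (h \<bullet> h) \<le> 0" using coercive[of h] that by simp
    with \<open>d > 0\<close> have "h \<bullet> h \<le> 0" by (simp add: mult_le_0_iff)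
    then show ?thesis by (metis inner_ge_zero inner_eq_zero_iff order.antisym)
  qed
  then have "invertible R"
    by (auto simp: invertible_left_inverse matrix_left_invertible_ker)
  then have RI: "R ** matrix_inv R = mat 1"
    unfolding invertible_def matrix_inv_def by (rule someI_ex[THEN conjunct1])
  define c where "c = matrix_inv R *v (L *v z)"
  have Rc: "R *v c = L *v z"
    by (simp add: c_def matrix_vector_mul_assoc RI matrix_mul_assoc)
  have s: "0 \<le> (Q *v z) \<bullet> z - c \<bullet> (L *v z)"
  proof -
    have "(Q - transpose L ** matrix_inv R ** L) *v z = Q *v z - transpose L *v c"
      unfolding c_def by (simp only: matrix_vector_mult_diff_rdistrib matrix_vector_mul_assoc matrix_mul_assoc)
    then have "0 \<le> (Q *v z - transpose L *v c) \<bullet> z"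
      using schur unfolding psd_def by metis
    then show ?thesis by (simp only: inner_diff_left inner_transpose_matrix)
  qed
  have "0 \<le> d * ((h + c) \<bullet> (h + c))" using \<open>d > 0\<close> by simp
  also have "\<dots> \<le> (R *v (h + c)) \<bullet> (h + c)" by (rule coercive)
  also have "\<dots> = (R *v h) \<bullet> h + 2 * (h \<bullet> (L *v z)) + c \<bullet> (L *v z)"
    using quadratic_form_add[OF sym, of h 1 c] inner_symmetric_matrix[OF sym, of h c]
    by (simp add: Rc inner_commute)
  finally show ?thesis using s by (simp only: inner_transpose_matrix)
qed


section \<open>Square integrable random variables\<close>

lemma subalgebra_refl: "subalgebra M M"
  by (simp add: subalgebra_def)

lemma L2_rvD:
  assumes "f \<in> L2_rv M F"
  shows "f \<in> borel_measurable F" "integrable M (\<lambda>w. (norm (f w))\<^sup>2)"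
  using assms by (auto simp: L2_rv_def)

lemma L2_rvI:
  assumes "subalgebra M F" "f \<in> borel_measurable F" "integrable M g"
    and "AE w in M. (norm (f w))\<^sup>2 \<le> g w"
  shows "f \<in> L2_rv M F"
  unfolding L2_rv_def
proof (safe intro!: assms(2))
  have [measurable]: "f \<in> borel_measurable M"
    by (rule measurable_from_subalg[OF assms(1,2)])
  show "integrable M (\<lambda>w. (norm (f w))\<^sup>2)"
    using assms(4) by (intro Bochner_Integration.integrable_bound[OF assms(3)]) auto
qed

lemma L2_rv_mono:
  assumes "f \<in> L2_rv M F" "subalgebra G F"
  shows "f \<in> L2_rv M G"
  using assms measurable_from_subalg[OF assms(2)] by (auto simp: L2_rv_def)

lemma norm_add_power2_le:
  fixes a b :: "'a::real_normed_vector"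
  shows "(norm (a + b))\<^sup>2 \<le> 2 * (norm a)\<^sup>2 + 2 * (norm b)\<^sup>2"
proof -
  have "(norm (a + b))\<^sup>2 \<le> (norm a + norm b)\<^sup>2"
    by (intro power_mono norm_triangle_ineq) auto
  also have "\<dots> \<le> 2 * (norm a)\<^sup>2 + 2 * (norm b)\<^sup>2"
    using sum_squares_bound[of "norm a" "norm b"] by (simp add: power2_sum)
  finally show ?thesis .
qed

lemma L2_rv_add:
  assumes "subalgebra M F" "f \<in> L2_rv M F" "g \<in> L2_rv M F"
  shows "(\<lambda>w. f w + g w) \<in> L2_rv M F"
proof (rule L2_rvI[OF assms(1)])
  show "(\<lambda>w. f w + g w) \<in> borel_measurable F"
    using assms(2,3)[THEN L2_rvD(1)] by simp
  show "integrable M (\<lambda>w. 2 * (norm (f w))\<^sup>2 + 2 * (norm (g w))\<^sup>2)"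
    using assms(2,3)[THEN L2_rvD(2)] by simp
qed (simp add: norm_add_power2_le)

lemma L2_rv_scaleR:
  assumes "f \<in> L2_rv M F"
  shows "(\<lambda>w. c *\<^sub>R f w) \<in> L2_rv M F"
  using L2_rvD[OF assms] by (auto simp: L2_rv_def power_mult_distrib)

lemma L2_rv_diff:
  assumes "subalgebra M F" "f \<in> L2_rv M F" "g \<in> L2_rv M F"
  shows "(\<lambda>w. f w - g w) \<in> L2_rv M F"
  using L2_rv_add[OF assms(1,2) L2_rv_scaleR[OF assms(3), of "-1"]] by simp

lemma (in finite_measure) L2_rv_const: "(\<lambda>w. c) \<in> L2_rv M F"
  by (simp add: L2_rv_def)

lemma borel_measurable_matrix_vector_mult:
  fixes A :: "'a \<Rightarrow> real ^ 'n ^ 'm"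
  assumes "A \<in> borel_measurable F" "f \<in> borel_measurable F"
  shows "(\<lambda>w. A w *v f w) \<in> borel_measurable F"
  using assms
  by (rule borel_measurable_continuous_Pair)
    (auto simp: matrix_vector_mult_def intro!: continuous_intros)

lemma borel_measurable_transpose:
  fixes A :: "'a \<Rightarrow> real ^ 'n ^ 'm"
  assumes "A \<in> borel_measurable F"
  shows "(\<lambda>w. transpose (A w)) \<in> borel_measurable F"
  using assms
  by (rule borel_measurable_continuous_on[rotated])
    (auto simp: transpose_def intro!: continuous_intros)

lemma L2_rv_matrix_vector_mult:
  fixes A :: "'a \<Rightarrow> real ^ 'n ^ 'm"
  assumes "subalgebra M F" "A \<in> Linf_rv M F" "f \<in> L2_rv M F"
  shows "(\<lambda>w. A w *v f w) \<in> L2_rv M F"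
proof -
  obtain c where c: "AE w in M. norm (A w) \<le> c"
    using assms(2) by (auto simp: Linf_rv_def)
  show ?thesis
  proof (rule L2_rvI[OF assms(1)])
    show "(\<lambda>w. A w *v f w) \<in> borel_measurable F"
      using assms(2) L2_rvD(1)[OF assms(3)]
      by (auto simp: Linf_rv_def intro: borel_measurable_matrix_vector_mult)
    show "integrable M (\<lambda>w. c\<^sup>2 * (norm (f w))\<^sup>2)"
      using L2_rvD(2)[OF assms(3)] by simp
    show "AE w in M. (norm (A w *v f w))\<^sup>2 \<le> c\<^sup>2 * (norm (f w))\<^sup>2"
      using c
    proof eventually_elim
      case (elim w)
      have "norm (A w *v f w) \<le> c * norm (f w)"
        by (rule order_trans[OF norm_matrix_vector_mult_le]) (simp add: elim mult_right_mono)
      then have "(norm (A w *v f w))\<^sup>2 \<le> (c * norm (f w))\<^sup>2"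
        by (intro power_mono) auto
      then show ?case by (simp add: power_mult_distrib)
    qed
  qed
qed

lemma Linf_rv_transpose:
  fixes A :: "'a \<Rightarrow> real ^ 'n ^ 'm"
  assumes "A \<in> Linf_rv M F"
  shows "(\<lambda>w. transpose (A w)) \<in> Linf_rv M F"
  using assms by (auto simp: Linf_rv_def norm_transpose borel_measurable_transpose)

lemma integrable_L2_inner:
  assumes "f \<in> L2_rv M M" "g \<in> L2_rv M M"
  shows "integrable M (\<lambda>w. f w \<bullet> g w)"
proof (rule Bochner_Integration.integrable_bound)
  show "integrable M (\<lambda>w. (norm (f w))\<^sup>2 + (norm (g w))\<^sup>2)"
    using assms[THEN L2_rvD(2)] by simp
  show "(\<lambda>w. f w \<bullet> g w) \<in> borel_measurable M"
    using assms[THEN L2_rvD(1)] by simp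
  have "\<bar>f w \<bullet> g w\<bar> \<le> (norm (f w))\<^sup>2 + (norm (g w))\<^sup>2" for w
  proof -
    have "\<bar>f w \<bullet> g w\<bar> \<le> norm (f w) * norm (g w)" by (rule Cauchy_Schwarz_ineq2)
    also have "\<dots> \<le> 2 * norm (f w) * norm (g w)" by simp
    also have "\<dots> \<le> (norm (f w))\<^sup>2 + (norm (g w))\<^sup>2" by (rule sum_squares_bound)
    finally show ?thesis .
  qed
  then show "AE w in M. norm (f w \<bullet> g w) \<le> norm ((norm (f w))\<^sup>2 + (norm (g w))\<^sup>2)"
    by simp
qed

lemma L2_rv_nth:
  fixes f :: "'a \<Rightarrow> real ^ 'n"
  assumes "subalgebra M F" "f \<in> L2_rv M F"
  shows "(\<lambda>w. f w $ i) \<in> L2_rv M F"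
proof (rule L2_rvI[OF assms(1)])
  have "(\<lambda>w. f w \<bullet> axis i 1) \<in> borel_measurable F"
    using L2_rvD(1)[OF assms(2)] by simp
  then show "(\<lambda>w. f w $ i) \<in> borel_measurable F"
    by (simp add: inner_axis)
  show "AE w in M. (norm (f w $ i))\<^sup>2 \<le> (norm (f w))\<^sup>2"
    by (simp add: abs_le_square_iff[symmetric] component_le_norm_cart)
qed (rule L2_rvD(2)[OF assms(2)])

text \<open>The \<open>F\<close>-measurable direction \<open>Z / (1 + \<bar>Z\<bar>)\<close> is bounded, hence admissible whatever the
  integrability of \<open>Z\<close>, and its inner product with \<open>Z\<close> is positive exactly where \<open>Z \<noteq> 0\<close>.\<close>

lemma (in finite_measure) AE_zero_if_orthogonal_to_L2:
  fixes Z :: "'a \<Rightarrow> 'e::euclidean_space"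
  assumes F: "subalgebra M F" and Z: "Z \<in> borel_measurable F"
    and int: "\<And>\<eta>. \<eta> \<in> L2_rv M F \<Longrightarrow> integrable M (\<lambda>w. Z w \<bullet> \<eta> w)"
    and zero: "\<And>\<eta>. \<eta> \<in> L2_rv M F \<Longrightarrow> (\<integral>w. Z w \<bullet> \<eta> w \<partial>M) = 0"
  shows "AE w in M. Z w = 0"
proof -
  define \<eta> where "\<eta> w = (1 / (1 + norm (Z w))) *\<^sub>R Z w" for w
  have "\<eta> \<in> L2_rv M F"
  proof (rule L2_rvI[OF F])
    show "\<eta> \<in> borel_measurable F"
      using Z unfolding \<eta>_def by measurable
    have "norm (\<eta> w) \<le> 1" for w
      using add_pos_nonneg[OF zero_less_one norm_ge_zero[of "Z w"]] by (simp add: \<eta>_def divide_le_eq_1)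
    then show "AE w in M. (norm (\<eta> w))\<^sup>2 \<le> 1"
      by (simp add: power_le_one)
  qed simp
  moreover have nonneg: "0 \<le> Z w \<bullet> \<eta> w" for w
    by (simp add: \<eta>_def)
  ultimately have "AE w in M. Z w \<bullet> \<eta> w = 0"
    using int zero by (subst integral_nonneg_eq_0_iff_AE[symmetric]) auto
  then show ?thesis
    by eventually_elim (auto simp: \<eta>_def add_nonneg_eq_0_iff)
qed


section \<open>Conditional expectations of random vectors\<close>

lemma borel_measurable_vec_cond_exp: "vec_cond_exp M F f \<in> borel_measurable F"
proof -
  have "(\<lambda>w. \<Sum>i\<in>UNIV. real_cond_exp M F (\<lambda>w'. f w' $ i) w *\<^sub>R axis i (1::real)) \<in> borel_measurable F"
    by measurable
  also have "(\<lambda>w. \<Sum>i\<in>UNIV. real_cond_exp M F (\<lambda>w'. f w' $ i) w *\<^sub>R axis i (1::real)) = vec_cond_exp M F f"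
    by (auto simp: vec_cond_exp_def vec_eq_iff axis_def fun_eq_iff if_distrib cong: if_cong)
  finally show ?thesis .
qed

text \<open>The factor \<open>g\<close> is pulled out coordinatewise, so only the coordinate products have to be
  integrable. This covers \<open>f = \<omega> y\<close> with \<open>y\<close> and \<open>\<omega> g\<close> square integrable, where
  \<open>f\<close> itself need not be square integrable.\<close>

lemma (in sigma_finite_subalgebra) vec_cond_exp_pairing:
  fixes f g :: "'a \<Rightarrow> real ^ 'n"
  assumes f: "f \<in> borel_measurable M" and g: "g \<in> borel_measurable F"
    and int: "\<And>i. integrable M (\<lambda>w. g w $ i * f w $ i)"
  shows "integrable M (\<lambda>w. vec_cond_exp M F f w \<bullet> g w)"
    and "integrable M (\<lambda>w. f w \<bullet> g w)"
    and "(\<integral>w. vec_cond_exp M F f w \<bullet> g w \<partial>M) = (\<integral>w. f w \<bullet> g w \<partial>M)"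
    and "AE w in M. real_cond_exp M F (\<lambda>w. f w \<bullet> g w) w = vec_cond_exp M F f w \<bullet> g w"
proof -
  have nth: "(\<lambda>w. h w $ i) \<in> borel_measurable G" if "h \<in> borel_measurable G"
    for h :: "'a \<Rightarrow> real ^ 'n" and G :: "'a measure" and i
  proof -
    have "(\<lambda>w. h w \<bullet> axis i 1) \<in> borel_measurable G" using that by simp
    then show ?thesis by (simp add: inner_axis)
  qed
  note cond = real_cond_exp_intg[OF int nth[OF g] nth[OF f]]
  have L: "vec_cond_exp M F f w \<bullet> g w
      = (\<Sum>i\<in>UNIV. g w $ i * real_cond_exp M F (\<lambda>w'. f w' $ i) w)" for w
    by (simp add: inner_vec_def vec_cond_exp_def mult.commute)
  have R: "f w \<bullet> g w = (\<Sum>i\<in>UNIV. g w $ i * f w $ i)" for w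
    by (simp add: inner_vec_def mult.commute)
  show "integrable M (\<lambda>w. vec_cond_exp M F f w \<bullet> g w)" "integrable M (\<lambda>w. f w \<bullet> g w)"
    unfolding L R using cond int by auto
  show "(\<integral>w. vec_cond_exp M F f w \<bullet> g w \<partial>M) = (\<integral>w. f w \<bullet> g w \<partial>M)"
    unfolding L R using cond int by (simp add: Bochner_Integration.integral_sum)
  have "AE w in M. \<forall>i\<in>UNIV. real_cond_exp M F (\<lambda>w. g w $ i * f w $ i) w
      = g w $ i * real_cond_exp M F (\<lambda>w'. f w' $ i) w"
    by (intro AE_finite_allI real_cond_exp_mult nth f g int) auto
  then show "AE w in M. real_cond_exp M F (\<lambda>w. f w \<bullet> g w) w = vec_cond_exp M F f w \<bullet> g w"
    using real_cond_exp_sum[where I = UNIV and f = "\<lambda>i w. g w $ i * f w $ i", OF int]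
    unfolding L R by eventually_elim simp
qed

text \<open>Multiplication by noise of unit conditional variance is an isometry on square integrable
  \<open>F\<close>-measurable vectors: condition \<open>\<omega>\<^sup>2 \<bar>f\<bar>\<^sup>2\<close> on \<open>F\<close>. Working with nonnegative integrals, no
  integrability of the product has to be known beforehand.\<close>

lemma (in sigma_finite_subalgebra) L2_rv_noise_scaleR:
  assumes e: "e \<in> borel_measurable M" "AE w in M. real_cond_exp M F (\<lambda>w. (e w)\<^sup>2) w = 1"
    and f: "f \<in> L2_rv M F"
    and G: "subalgebra M G" "subalgebra G F" "e \<in> borel_measurable G"
  shows "(\<lambda>w. e w *\<^sub>R f w) \<in> L2_rv M G"
proof -
  note [measurable] = e(1) L2_rvD(1)[OF f] measurable_from_subalg[OF subalg L2_rvD(1)[OF f]]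
  have "AE w in M. nn_cond_exp M F (\<lambda>w. ennreal ((e w)\<^sup>2)) w = 1"
  proof -
    have "AE w in M. nn_cond_exp M F (\<lambda>w. ennreal (- (e w)\<^sup>2)) w = 0"
      using nn_cond_exp_F_meas[of "\<lambda>w. 0"] by (auto simp: ennreal_neg)
    with e(2) show ?thesis
    proof eventually_elim
      case (elim w)
      then have "enn2real (nn_cond_exp M F (\<lambda>w. ennreal ((e w)\<^sup>2)) w) = 1"
        by (simp add: real_cond_exp_def)
      then show ?case
        by (cases "nn_cond_exp M F (\<lambda>w. ennreal ((e w)\<^sup>2)) w") auto
    qed
  qed
  then have "(\<integral>\<^sup>+ w. ennreal ((norm (f w))\<^sup>2) * nn_cond_exp M F (\<lambda>w. ennreal ((e w)\<^sup>2)) w \<partial>M)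
      = (\<integral>\<^sup>+ w. ennreal ((norm (f w))\<^sup>2) \<partial>M)"
    by (intro nn_integral_cong_AE) auto
  also have "\<dots> < \<infinity>"
    using L2_rvD(2)[OF f] by (auto simp: integrable_iff_bounded)
  finally have "(\<integral>\<^sup>+ w. ennreal ((norm (f w))\<^sup>2) * ennreal ((e w)\<^sup>2) \<partial>M) < \<infinity>"
    by (subst (asm) nn_cond_exp_intg) auto
  moreover have "ennreal ((norm (f w))\<^sup>2) * ennreal ((e w)\<^sup>2) = ennreal (norm ((norm (e w *\<^sub>R f w))\<^sup>2))" for w
    by (subst ennreal_mult[symmetric]) (auto simp: power_mult_distrib mult.commute)
  ultimately have "integrable M (\<lambda>w. (norm (e w *\<^sub>R f w))\<^sup>2)"
    by (intro integrableI_bounded) simp_all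
  then show ?thesis
    using G(3) measurable_from_subalg[OF G(2) L2_rvD(1)[OF f]] by (auto simp: L2_rv_def)
qed

section \<open>First-order conditions for quadratic functionals\<close>

lemma linear_coeff_zero_if_quadratic_nonneg:
  fixes a b :: real
  assumes "\<And>e. 0 \<le> e * a + e\<^sup>2 * b"
  shows "a = 0"
proof (rule ccontr)
  assume "a \<noteq> 0"
  define c where "c = \<bar>b\<bar> + 1"
  have c: "c > 0" "b < c" by (auto simp: c_def)
  \<comment> \<open>At \<open>e = - a / c\<close> the quadratic is \<open>a\<^sup>2 (b - c) / c\<^sup>2\<close>.\<close>
  have "0 \<le> (- a / c) * a + (- a / c)\<^sup>2 * b" by (rule assms)
  also have "\<dots> = a\<^sup>2 * (b - c) / c\<^sup>2"
    using c by (simp add: power2_eq_square field_simps)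
  also have "\<dots> < 0"
    using c \<open>a \<noteq> 0\<close> by (intro divide_neg_pos mult_pos_neg) auto
  finally show False by simp
qed

text \<open>The \<open>L\<^sup>1\<close> norms of \<open>a\<close> and \<open>a + e b\<close> differ by at most \<open>\<bar>e\<bar>\<close> times the \<open>L\<^sup>1\<close> norm of \<open>b\<close>.\<close>

lemma nn_integral_affine_tendsto_0_iff:
  fixes a b :: "'a \<Rightarrow> real"
  assumes a: "integrable M a" and b: "integrable M b"
  shows "((\<lambda>e::real. \<integral>\<^sup>+ w. ennreal \<bar>a w + e * b w\<bar> \<partial>M) \<longlongrightarrow> 0) (at 0) \<longleftrightarrow> (AE w in M. a w = 0)"
proof
  note [measurable] = borel_measurable_integrable[OF a] borel_measurable_integrable[OF b]
  define K where "K = (\<integral>w. \<bar>b w\<bar> \<partial>M)"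
  have K: "(\<integral>\<^sup>+ w. ennreal \<bar>e * b w\<bar> \<partial>M) = ennreal (\<bar>e\<bar> * K)" for e
    using b unfolding K_def
    by (subst nn_integral_eq_integral) (auto simp: abs_mult)
  have "((\<lambda>e. ennreal (\<bar>e\<bar> * K)) \<longlongrightarrow> ennreal (\<bar>0\<bar> * K)) (at (0::real))"
    by (intro tendsto_ennrealI tendsto_intros)
  then have K0: "((\<lambda>e. ennreal (\<bar>e\<bar> * K)) \<longlongrightarrow> 0) (at (0::real))"
    by simp
  {
    assume "AE w in M. a w = 0"
    then have "(\<integral>\<^sup>+ w. ennreal \<bar>a w + e * b w\<bar> \<partial>M) = ennreal (\<bar>e\<bar> * K)" for e
      unfolding K[symmetric] by (intro nn_integral_cong_AE) auto
    then show "((\<lambda>e::real. \<integral>\<^sup>+ w. ennreal \<bar>a w + e * b w\<bar> \<partial>M) \<longlongrightarrow> 0) (at 0)"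
      using K0 by simp
  next
    assume lim: "((\<lambda>e::real. \<integral>\<^sup>+ w. ennreal \<bar>a w + e * b w\<bar> \<partial>M) \<longlongrightarrow> 0) (at 0)"
    have "(\<integral>\<^sup>+ w. ennreal \<bar>a w\<bar> \<partial>M) \<le> (\<integral>\<^sup>+ w. ennreal \<bar>a w + e * b w\<bar> \<partial>M) + ennreal (\<bar>e\<bar> * K)"
      for e :: real
    proof -
      have "(\<integral>\<^sup>+ w. ennreal \<bar>a w\<bar> \<partial>M)
          \<le> (\<integral>\<^sup>+ w. ennreal \<bar>a w + e * b w\<bar> + ennreal \<bar>e * b w\<bar> \<partial>M)"
        by (intro nn_integral_mono) (auto simp flip: ennreal_plus intro!: ennreal_leI)
      then show ?thesis
        unfolding K[symmetric] by (subst (asm) nn_integral_add) auto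
    qed
    moreover have "((\<lambda>e::real. (\<integral>\<^sup>+ w. ennreal \<bar>a w + e * b w\<bar> \<partial>M) + ennreal (\<bar>e\<bar> * K)) \<longlongrightarrow> 0 + 0) (at 0)"
      by (intro tendsto_add lim K0)
    ultimately have "(\<integral>\<^sup>+ w. ennreal \<bar>a w\<bar> \<partial>M) \<le> 0 + 0"
      by (intro tendsto_lowerbound[where F = "at (0::real)"]) (auto intro!: always_eventually)
    then show "AE w in M. a w = 0"
      by (simp add: nn_integral_0_iff_AE)
  }
qed

lemma stage_cost_add:
  fixes Q :: "real ^ 'n ^ 'n" and R :: "real ^ 'm ^ 'm" and L :: "real ^ 'n ^ 'm"
  assumes Q: "transpose Q = Q" and R: "transpose R = R"
  shows "(Q *v (x + e *\<^sub>R z)) \<bullet> (x + e *\<^sub>R z)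
      + 2 * ((transpose L *v (u + e *\<^sub>R h)) \<bullet> (x + e *\<^sub>R z))
      + (R *v (u + e *\<^sub>R h)) \<bullet> (u + e *\<^sub>R h)
      + 2 * (q \<bullet> (x + e *\<^sub>R z)) + 2 * (r \<bullet> (u + e *\<^sub>R h))
    = ((Q *v x) \<bullet> x + 2 * ((transpose L *v u) \<bullet> x) + (R *v u) \<bullet> u + 2 * (q \<bullet> x) + 2 * (r \<bullet> u))
      + 2 * e * ((Q *v x + transpose L *v u + q) \<bullet> z + (L *v x + R *v u + r) \<bullet> h)
      + e\<^sup>2 * ((Q *v z) \<bullet> z + 2 * ((transpose L *v h) \<bullet> z) + (R *v h) \<bullet> h)"
  unfolding quadratic_form_add[OF Q] quadratic_form_add[OF R] inner_transpose_matrix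
  by (simp only: inner_transpose_matrix inner_add_left inner_add_right inner_scaleR_left
      inner_scaleR_right matrix_vector_right_distrib matrix_vector_mult_scaleR
      inner_commute[of "L *v x" h])
    (simp add: power2_eq_square algebra_simps)


section \<open>The standing assumptions\<close>

text \<open>The derivative of the state with respect to Player 1's control in the direction \<open>\<eta>\<close>; by
  linearity it does not depend on the control at which it is taken.\<close>

primrec lq_variation ::
  "('a, 'n::finite, 'm::finite, 'l::finite) lq_game
    \<Rightarrow> (nat \<Rightarrow> 'a \<Rightarrow> real ^ 'm) \<Rightarrow> nat \<Rightarrow> 'a \<Rightarrow> real ^ 'n" where
  "lq_variation \<Gamma> \<eta> 0 = (\<lambda>w. 0)"
| "lq_variation \<Gamma> \<eta> (Suc k) = (\<lambda>w.
     coef_A \<Gamma> k w *v lq_variation \<Gamma> \<eta> k w + coef_B \<Gamma> k w *v \<eta> k w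
     + noise \<Gamma> k w *\<^sub>R (coef_D \<Gamma> k w *v lq_variation \<Gamma> \<eta> k w + coef_E \<Gamma> k w *v \<eta> k w))"

lemma lq_state_add:
  "lq_state \<Gamma> \<xi> (\<lambda>k w. u k w + e *\<^sub>R \<eta> k w) v k w
     = lq_state \<Gamma> \<xi> u v k w + e *\<^sub>R lq_variation \<Gamma> \<eta> k w"
  by (induction k)
    (simp_all add: matrix_vector_right_distrib matrix_vector_mult_scaleR scaleR_add_right
      mult.commute)

text \<open>The candidate for \<open>\<partial>\<^sub>u H\<^sub>1\<close> along the state \<open>x\<close>, the control \<open>u\<close> and the adjoint process \<open>y\<close>.\<close>

definition stationarity1 ::
  "('a, 'n::finite, 'm::finite, 'l::finite) lq_game \<Rightarrow> (nat \<Rightarrow> 'a \<Rightarrow> real ^ 'n)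
    \<Rightarrow> (nat \<Rightarrow> 'a \<Rightarrow> real ^ 'm) \<Rightarrow> (nat \<Rightarrow> 'a \<Rightarrow> real ^ 'n) \<Rightarrow> nat \<Rightarrow> 'a \<Rightarrow> real ^ 'm" where
  "stationarity1 \<Gamma> x u y k = (\<lambda>w.
     transpose (coef_B \<Gamma> k w) *v adj_mean \<Gamma> y k w
     + transpose (coef_E \<Gamma> k w) *v adj_noise \<Gamma> y k w
     + coef_L \<Gamma> k w *v x k w + coef_R \<Gamma> k w *v u k w + coef_rho \<Gamma> k w)"

locale lq_standing =
  fixes \<Gamma> :: "('a, 'n::finite, 'm::finite, 'l::finite) lq_game"
  assumes noise_ok: "noise_assumptions \<Gamma>"
    and coef_ok: "coefficient_assumptions \<Gamma>"
    and convex_ok: "convexity_assumptions \<Gamma>"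
begin

abbreviation "\<M> \<equiv> pspace \<Gamma>"
abbreviation "N \<equiv> horizon \<Gamma>"

sublocale prob_space \<M>
  using noise_ok by (simp add: noise_assumptions_def)

lemma borel_measurable_noise: "k < N \<Longrightarrow> noise \<Gamma> k \<in> borel_measurable \<M>"
  using noise_ok by (simp add: noise_assumptions_def)

lemma space_past: "space (past \<Gamma> k) = space \<M>"
  by (simp add: past_def space_measure_of_conv)

abbreviation past_generators :: "nat \<Rightarrow> 'a set set" where
  "past_generators k \<equiv>
     {noise \<Gamma> i -` X \<inter> space \<M> | i X. i < k \<and> X \<in> sets borel} \<union> null_sets \<M>"

lemma past_generators_sets:
  assumes "k \<le> N"
  shows "past_generators k \<subseteq> sets \<M>"
  using assms borel_measurable_noise by (auto intro!: measurable_sets)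

lemma sets_past:
  assumes "k \<le> N"
  shows "sets (past \<Gamma> k) = sigma_sets (space \<M>) (if k = 0 then {} else past_generators k)"
proof -
  have "past_generators k \<subseteq> Pow (space \<M>)"
    using past_generators_sets[OF assms] sets.sets_into_space by blast
  then show ?thesis by (simp add: past_def)
qed

lemma subalgebra_past:
  assumes "k \<le> N"
  shows "subalgebra \<M> (past \<Gamma> k)"
  using sets.sigma_sets_subset[of "if k = 0 then {} else past_generators k" \<M>]
    past_generators_sets[OF assms]
  unfolding subalgebra_def space_past sets_past[OF assms] by auto

lemma subalgebra_past_Suc:
  assumes "k < N"
  shows "subalgebra (past \<Gamma> (Suc k)) (past \<Gamma> k)"
proof -
  have k: "k \<le> N" "Suc k \<le> N" using assms by auto
  have "{noise \<Gamma> i -` X \<inter> space \<M> | i X. i < k \<and> X \<in> sets borel}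
      \<subseteq> {noise \<Gamma> i -` X \<inter> space \<M> | i X. i < Suc k \<and> X \<in> sets borel}"
    by (intro Collect_mono ex_mono impI conj_mono) (auto intro: less_SucI)
  then have "past_generators k \<subseteq> past_generators (Suc k)"
    by (rule Un_mono) (rule order.refl)
  then have "(if k = 0 then {} else past_generators k)
      \<subseteq> (if Suc k = 0 then {} else past_generators (Suc k))"
    by (simp only: nat.distinct if_False split: if_split) simp
  from sigma_sets_mono'[OF this] show ?thesis
    unfolding subalgebra_def space_past sets_past[OF k(1)] sets_past[OF k(2)] by blast
qed

lemma noise_past_Suc:
  assumes "k < N"
  shows "noise \<Gamma> k \<in> borel_measurable (past \<Gamma> (Suc k))"
  using assms
  by (intro measurableI) (auto simp: space_past sets_past intro!: sigma_sets.Basic)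

lemma sigma_finite_subalgebra_past:
  assumes "k \<le> N"
  shows "sigma_finite_subalgebra \<M> (past \<Gamma> k)"
  by (intro finite_measure_subalgebra_is_sigma_finite finite_measure_subalgebra.intro
      finite_measure_axioms finite_measure_subalgebra_axioms.intro subalgebra_past assms)

lemma L2_proc_iff:
  assumes "I \<subseteq> {..N}"
  shows "f \<in> L2_proc \<Gamma> I \<longleftrightarrow> (\<forall>k\<in>I. f k \<in> L2_rv \<M> (past \<Gamma> k))"
proof
  assume f: "f \<in> L2_proc \<Gamma> I"
  show "\<forall>k\<in>I. f k \<in> L2_rv \<M> (past \<Gamma> k)"
  proof
    fix k assume "k \<in> I"
    moreover have "finite I" using assms finite_subset by blast
    ultimately show "f k \<in> L2_rv \<M> (past \<Gamma> k)"
      using f assms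
      by (intro L2_rvI[where g = "\<lambda>w. \<Sum>k\<in>I. (norm (f k w))\<^sup>2"] subalgebra_past)
        (auto simp: L2_proc_def intro!: member_le_sum AE_I2)
  qed
next
  assume "\<forall>k\<in>I. f k \<in> L2_rv \<M> (past \<Gamma> k)"
  then show "f \<in> L2_proc \<Gamma> I"
    by (auto simp: L2_proc_def L2_rv_def)
qed

lemma Linf_procD:
  assumes "f \<in> Linf_proc \<Gamma> {..<N}" "k < N"
  shows "f k \<in> Linf_rv \<M> (past \<Gamma> k)"
  using assms by (fastforce simp: Linf_proc_def Linf_rv_def elim: eventually_mono)

lemma coef_Linf:
  assumes "k < N"
  shows "coef_A \<Gamma> k \<in> Linf_rv \<M> (past \<Gamma> k)" "coef_D \<Gamma> k \<in> Linf_rv \<M> (past \<Gamma> k)"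
    "coef_B \<Gamma> k \<in> Linf_rv \<M> (past \<Gamma> k)" "coef_E \<Gamma> k \<in> Linf_rv \<M> (past \<Gamma> k)"
    "coef_C \<Gamma> k \<in> Linf_rv \<M> (past \<Gamma> k)" "coef_F \<Gamma> k \<in> Linf_rv \<M> (past \<Gamma> k)"
    "coef_Q \<Gamma> k \<in> Linf_rv \<M> (past \<Gamma> k)" "coef_L \<Gamma> k \<in> Linf_rv \<M> (past \<Gamma> k)"
    "coef_R \<Gamma> k \<in> Linf_rv \<M> (past \<Gamma> k)"
  using coef_ok assms by (auto simp: coefficient_assumptions_def intro: Linf_procD)

lemma coef_L2:
  assumes "k < N"
  shows "coef_b \<Gamma> k \<in> L2_rv \<M> (past \<Gamma> k)" "coef_sigma \<Gamma> k \<in> L2_rv \<M> (past \<Gamma> k)"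
    "coef_q \<Gamma> k \<in> L2_rv \<M> (past \<Gamma> k)" "coef_rho \<Gamma> k \<in> L2_rv \<M> (past \<Gamma> k)"
proof -
  have sub: "{..<N} \<subseteq> {..N}" by auto
  show "coef_b \<Gamma> k \<in> L2_rv \<M> (past \<Gamma> k)" "coef_sigma \<Gamma> k \<in> L2_rv \<M> (past \<Gamma> k)"
    "coef_q \<Gamma> k \<in> L2_rv \<M> (past \<Gamma> k)" "coef_rho \<Gamma> k \<in> L2_rv \<M> (past \<Gamma> k)"
    using coef_ok assms by (auto simp: coefficient_assumptions_def L2_proc_iff[OF sub])
qed

lemma terminal_coef:
  shows "term_G \<Gamma> \<in> Linf_rv \<M> (past \<Gamma> N)" "term_g \<Gamma> \<in> L2_rv \<M> (past \<Gamma> N)"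
  using coef_ok by (auto simp: coefficient_assumptions_def)

lemma controls_iff:
  shows "u \<in> controls1 \<Gamma> \<longleftrightarrow> (\<forall>k<N. u k \<in> L2_rv \<M> (past \<Gamma> k))"
    and "v \<in> controls2 \<Gamma> \<longleftrightarrow> (\<forall>k<N. v k \<in> L2_rv \<M> (past \<Gamma> k))"
proof -
  have sub: "{..<N} \<subseteq> {..N}" by auto
  show "u \<in> controls1 \<Gamma> \<longleftrightarrow> (\<forall>k<N. u k \<in> L2_rv \<M> (past \<Gamma> k))"
    "v \<in> controls2 \<Gamma> \<longleftrightarrow> (\<forall>k<N. v k \<in> L2_rv \<M> (past \<Gamma> k))"
    by (auto simp: controls1_def controls2_def L2_proc_iff[OF sub])
qed

lemma L2_past_add:
  "k \<le> N \<Longrightarrow> f \<in> L2_rv \<M> (past \<Gamma> k) \<Longrightarrow> g \<in> L2_rv \<M> (past \<Gamma> k)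
    \<Longrightarrow> (\<lambda>w. f w + g w) \<in> L2_rv \<M> (past \<Gamma> k)"
  by (intro L2_rv_add subalgebra_past)

lemma L2_past_matrix_vector_mult:
  fixes A :: "'a \<Rightarrow> real ^ 'i::finite ^ 'j::finite"
  shows "k \<le> N \<Longrightarrow> A \<in> Linf_rv \<M> (past \<Gamma> k) \<Longrightarrow> f \<in> L2_rv \<M> (past \<Gamma> k)
    \<Longrightarrow> (\<lambda>w. A w *v f w) \<in> L2_rv \<M> (past \<Gamma> k)"
  by (intro L2_rv_matrix_vector_mult subalgebra_past)

lemma L2_past_Suc:
  assumes "k < N" "f \<in> L2_rv \<M> (past \<Gamma> k)"
  shows "f \<in> L2_rv \<M> (past \<Gamma> (Suc k))"
  using assms by (intro L2_rv_mono[OF _ subalgebra_past_Suc])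

lemma L2_past_noise:
  assumes "k < N" "f \<in> L2_rv \<M> (past \<Gamma> k)"
  shows "(\<lambda>w. noise \<Gamma> k w *\<^sub>R f w) \<in> L2_rv \<M> (past \<Gamma> (Suc k))"
proof -
  interpret S: sigma_finite_subalgebra \<M> "past \<Gamma> k"
    using assms by (intro sigma_finite_subalgebra_past) simp
  show ?thesis
    using assms noise_ok
    by (intro S.L2_rv_noise_scaleR subalgebra_past subalgebra_past_Suc noise_past_Suc)
      (auto simp: noise_assumptions_def)
qed

lemma integrable_past_inner:
  assumes "k \<le> N" "f \<in> L2_rv \<M> (past \<Gamma> k)" "g \<in> L2_rv \<M> (past \<Gamma> k)"
  shows "integrable \<M> (\<lambda>w. f w \<bullet> g w)"
  using assms by (intro integrable_L2_inner L2_rv_mono[OF _ subalgebra_past])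

lemma lq_state_L2:
  assumes "u \<in> controls1 \<Gamma>" "v \<in> controls2 \<Gamma>" "k \<le> N"
  shows "lq_state \<Gamma> \<xi> u v k \<in> L2_rv \<M> (past \<Gamma> k)"
  using assms(3)
proof (induction k)
  case 0
  then show ?case by (simp add: L2_rv_const)
next
  case (Suc k)
  then have k: "k \<le> N" "k < N" "Suc k \<le> N" by auto
  have drift: "(\<lambda>w. coef_A \<Gamma> k w *v lq_state \<Gamma> \<xi> u v k w + coef_B \<Gamma> k w *v u k w
      + coef_C \<Gamma> k w *v v k w + coef_b \<Gamma> k w) \<in> L2_rv \<M> (past \<Gamma> k)"
    and diffusion: "(\<lambda>w. coef_D \<Gamma> k w *v lq_state \<Gamma> \<xi> u v k w + coef_E \<Gamma> k w *v u k w
      + coef_F \<Gamma> k w *v v k w + coef_sigma \<Gamma> k w) \<in> L2_rv \<M> (past \<Gamma> k)"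
    using Suc.IH k assms
    by (auto simp: controls_iff intro!: L2_past_add L2_past_matrix_vector_mult coef_Linf coef_L2)
  show ?case
    using L2_past_add[OF k(3) L2_past_Suc[OF k(2) drift] L2_past_noise[OF k(2) diffusion]]
    by simp
qed

lemma lq_variation_L2:
  assumes "\<eta> \<in> controls1 \<Gamma>" "k \<le> N"
  shows "lq_variation \<Gamma> \<eta> k \<in> L2_rv \<M> (past \<Gamma> k)"
  using assms(2)
proof (induction k)
  case 0
  then show ?case by (simp add: L2_rv_const)
next
  case (Suc k)
  then have k: "k \<le> N" "k < N" "Suc k \<le> N" by auto
  have drift: "(\<lambda>w. coef_A \<Gamma> k w *v lq_variation \<Gamma> \<eta> k w + coef_B \<Gamma> k w *v \<eta> k w) \<in> L2_rv \<M> (past \<Gamma> k)"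
    and diffusion: "(\<lambda>w. coef_D \<Gamma> k w *v lq_variation \<Gamma> \<eta> k w + coef_E \<Gamma> k w *v \<eta> k w) \<in> L2_rv \<M> (past \<Gamma> k)"
    using Suc.IH k assms
    by (auto simp: controls_iff intro!: L2_past_add L2_past_matrix_vector_mult coef_Linf coef_L2)
  show ?case
    using L2_past_add[OF k(3) L2_past_Suc[OF k(2) drift] L2_past_noise[OF k(2) diffusion]]
    by simp
qed

lemma coef_symmetric:
  "AE w in \<M>. transpose (term_G \<Gamma> w) = term_G \<Gamma> w
     \<and> (\<forall>k<N. transpose (coef_Q \<Gamma> k w) = coef_Q \<Gamma> k w \<and> transpose (coef_R \<Gamma> k w) = coef_R \<Gamma> k w)"
  using convex_ok[unfolded convexity_assumptions_def, THEN conjunct1] by eventually_elim simp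

lemma second_variation_nonneg:
  "0 \<le> (\<integral>w. (term_G \<Gamma> w *v z N w) \<bullet> z N w
         + (\<Sum>k<N. (coef_Q \<Gamma> k w *v z k w) \<bullet> z k w
              + 2 * ((transpose (coef_L \<Gamma> k w) *v h k w) \<bullet> z k w)
              + (coef_R \<Gamma> k w *v h k w) \<bullet> h k w) \<partial>\<M>)"
proof (rule Bochner_Integration.integral_nonneg_AE)
  obtain d where "d > 0" and psd: "AE w in \<M>. psd (term_G \<Gamma> w) \<and> psd (term_H \<Gamma> w) \<and>
        (\<forall>k\<in>stages \<Gamma>.
           psd (coef_R \<Gamma> k w - mat d) \<and> psd (coef_S \<Gamma> k w - mat d) \<and>
           psd (coef_Q \<Gamma> k w
                - transpose (coef_L \<Gamma> k w) ** matrix_inv (coef_R \<Gamma> k w) ** coef_L \<Gamma> k w) \<and>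
           psd (coef_P \<Gamma> k w
                - transpose (coef_M \<Gamma> k w) ** matrix_inv (coef_S \<Gamma> k w) ** coef_M \<Gamma> k w))"
    using convex_ok unfolding convexity_assumptions_def by blast
  from psd coef_symmetric
  show "AE w in \<M>. 0 \<le> (term_G \<Gamma> w *v z N w) \<bullet> z N w
         + (\<Sum>k<N. (coef_Q \<Gamma> k w *v z k w) \<bullet> z k w
              + 2 * ((transpose (coef_L \<Gamma> k w) *v h k w) \<bullet> z k w)
              + (coef_R \<Gamma> k w *v h k w) \<bullet> h k w)"
  proof eventually_elim
    case (elim w)
    then show ?case
      using \<open>d > 0\<close>
      by (intro add_nonneg_nonneg sum_nonneg block_form_nonneg[where d = d]) (auto simp: psd_def)
  qed
qed

end

section \<open>Variation of Player 1's cost\<close>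

locale lq_adjoint = lq_standing \<Gamma>
  for \<Gamma> :: "('a, 'n::finite, 'm::finite, 'l::finite) lq_game" +
  fixes \<xi> :: "real ^ 'n"
    and u :: "nat \<Rightarrow> 'a \<Rightarrow> real ^ 'm"
    and v :: "nat \<Rightarrow> 'a \<Rightarrow> real ^ 'l"
    and y :: "nat \<Rightarrow> 'a \<Rightarrow> real ^ 'n"
  assumes u: "u \<in> controls1 \<Gamma>" and v: "v \<in> controls2 \<Gamma>"
    and adjoint: "adjoint1 \<Gamma> (lq_state \<Gamma> \<xi> u v) u y"
begin

abbreviation "x \<equiv> lq_state \<Gamma> \<xi> u v"
abbreviation "\<Psi> \<equiv> stationarity1 \<Gamma> x u y"

lemma x_L2: "k \<le> N \<Longrightarrow> x k \<in> L2_rv \<M> (past \<Gamma> k)"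
  by (intro lq_state_L2 u v)

lemma u_L2: "k < N \<Longrightarrow> u k \<in> L2_rv \<M> (past \<Gamma> k)"
  using u by (simp add: controls_iff)

lemma v_L2: "k < N \<Longrightarrow> v k \<in> L2_rv \<M> (past \<Gamma> k)"
  using v by (simp add: controls_iff)

lemma y_L2: "k \<le> N \<Longrightarrow> y k \<in> L2_rv \<M> (past \<Gamma> k)"
  using adjoint by (auto simp: adjoint1_def L2_proc_iff)

text \<open>Pairing \<open>\<E>[y\<^sub>k\<^sub>+\<^sub>1 \<omega>\<^sub>k | \<F>\<^sub>k\<^sub>-\<^sub>1]\<close> with \<open>g\<close> is legitimate because \<open>\<omega>\<^sub>k g\<close> is square integrable: the
  noise is moved from \<open>y\<^sub>k\<^sub>+\<^sub>1\<close>, whose product with it is only integrable, to \<open>g\<close>.\<close>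

lemma adjoint_pairing:
  assumes "k < N" "f \<in> L2_rv \<M> (past \<Gamma> k)" "g \<in> L2_rv \<M> (past \<Gamma> k)"
  shows "integrable \<M> (\<lambda>w. adj_mean \<Gamma> y k w \<bullet> f w + adj_noise \<Gamma> y k w \<bullet> g w)"
    and "(\<integral>w. y (Suc k) w \<bullet> f w + (noise \<Gamma> k w *\<^sub>R y (Suc k) w) \<bullet> g w \<partial>\<M>)
      = (\<integral>w. adj_mean \<Gamma> y k w \<bullet> f w + adj_noise \<Gamma> y k w \<bullet> g w \<partial>\<M>)"
    and "AE w in \<M>. real_cond_exp \<M> (past \<Gamma> k)
        (\<lambda>w. y (Suc k) w \<bullet> f w + (noise \<Gamma> k w *\<^sub>R y (Suc k) w) \<bullet> g w) w
      = adj_mean \<Gamma> y k w \<bullet> f w + adj_noise \<Gamma> y k w \<bullet> g w"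
proof -
  have k: "k \<le> N" "Suc k \<le> N" using assms by auto
  interpret S: sigma_finite_subalgebra \<M> "past \<Gamma> k"
    using k by (intro sigma_finite_subalgebra_past)
  have yM: "y (Suc k) \<in> L2_rv \<M> \<M>"
    using k y_L2[of "Suc k"] by (intro L2_rv_mono[OF _ subalgebra_past]) auto
  have prod: "integrable \<M> (\<lambda>w. h w $ i * y (Suc k) w $ i)" if "h \<in> L2_rv \<M> \<M>" for h i
    using integrable_L2_inner[OF L2_rv_nth[OF subalgebra_refl that, of i] L2_rv_nth[OF subalgebra_refl yM, of i]]
    by simp
  have fM: "f \<in> L2_rv \<M> \<M>"
    using k assms by (intro L2_rv_mono[OF _ subalgebra_past]) auto
  have gM: "(\<lambda>w. noise \<Gamma> k w *\<^sub>R g w) \<in> L2_rv \<M> \<M>"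
    using k assms L2_past_noise by (intro L2_rv_mono[OF _ subalgebra_past]) auto
  note mean = S.vec_cond_exp_pairing[OF L2_rvD(1)[OF yM] L2_rvD(1)[OF assms(2)] prod[OF fM],
      folded adj_mean_def]
  have noisy_meas: "(\<lambda>w. noise \<Gamma> k w *\<^sub>R y (Suc k) w) \<in> borel_measurable \<M>"
    using borel_measurable_noise[OF assms(1)] L2_rvD(1)[OF yM] by simp
  have noisy_prod: "integrable \<M> (\<lambda>w. g w $ i * (noise \<Gamma> k w *\<^sub>R y (Suc k) w) $ i)" for i
    using prod[OF gM, of i] by (simp add: mult_ac)
  note noisy = S.vec_cond_exp_pairing[OF noisy_meas L2_rvD(1)[OF assms(3)] noisy_prod,
      folded adj_noise_def]
  show "integrable \<M> (\<lambda>w. adj_mean \<Gamma> y k w \<bullet> f w + adj_noise \<Gamma> y k w \<bullet> g w)"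
    by (intro Bochner_Integration.integrable_add mean noisy)
  show "(\<integral>w. y (Suc k) w \<bullet> f w + (noise \<Gamma> k w *\<^sub>R y (Suc k) w) \<bullet> g w \<partial>\<M>)
      = (\<integral>w. adj_mean \<Gamma> y k w \<bullet> f w + adj_noise \<Gamma> y k w \<bullet> g w \<partial>\<M>)"
    by (simp only: Bochner_Integration.integral_add mean noisy)
  from S.real_cond_exp_add[OF mean(2) noisy(2)] mean(4) noisy(4)
  show "AE w in \<M>. real_cond_exp \<M> (past \<Gamma> k)
        (\<lambda>w. y (Suc k) w \<bullet> f w + (noise \<Gamma> k w *\<^sub>R y (Suc k) w) \<bullet> g w) w
      = adj_mean \<Gamma> y k w \<bullet> f w + adj_noise \<Gamma> y k w \<bullet> g w"
    by eventually_elim simp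
qed

lemma borel_measurable_adj:
  "adj_mean \<Gamma> y k \<in> borel_measurable (past \<Gamma> k)" "adj_noise \<Gamma> y k \<in> borel_measurable (past \<Gamma> k)"
  by (simp_all add: adj_mean_def adj_noise_def borel_measurable_vec_cond_exp)

lemma borel_measurable_stationarity:
  assumes "k < N"
  shows "\<Psi> k \<in> borel_measurable (past \<Gamma> k)"
proof -
  have "(\<lambda>w. coef_L \<Gamma> k w *v x k w) \<in> L2_rv \<M> (past \<Gamma> k)"
    "(\<lambda>w. coef_R \<Gamma> k w *v u k w) \<in> L2_rv \<M> (past \<Gamma> k)"
    using assms by (auto intro!: L2_past_matrix_vector_mult coef_Linf x_L2 u_L2)
  moreover have "(\<lambda>w. transpose (coef_B \<Gamma> k w) *v adj_mean \<Gamma> y k w) \<in> borel_measurable (past \<Gamma> k)"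
    "(\<lambda>w. transpose (coef_E \<Gamma> k w) *v adj_noise \<Gamma> y k w) \<in> borel_measurable (past \<Gamma> k)"
    using coef_Linf[OF assms]
    by (auto simp del: transpose_matrix_vector simp: Linf_rv_def
        intro!: borel_measurable_matrix_vector_mult borel_measurable_transpose borel_measurable_adj)
  ultimately show ?thesis
    unfolding stationarity1_def using coef_L2(4)[OF assms]
    by (intro borel_measurable_add) (auto dest: L2_rvD(1) simp del: transpose_matrix_vector)
qed

lemma stationarity_inner:
  "\<Psi> k w \<bullet> h = adj_mean \<Gamma> y k w \<bullet> (coef_B \<Gamma> k w *v h) + adj_noise \<Gamma> y k w \<bullet> (coef_E \<Gamma> k w *v h)
     + (coef_L \<Gamma> k w *v x k w + coef_R \<Gamma> k w *v u k w + coef_rho \<Gamma> k w) \<bullet> h"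
  unfolding stationarity1_def by (simp only: inner_add_left inner_transpose_matrix add.assoc)

lemma integrable_stationarity_inner:
  assumes "k < N" "h \<in> L2_rv \<M> (past \<Gamma> k)"
  shows "integrable \<M> (\<lambda>w. \<Psi> k w \<bullet> h w)"
  unfolding stationarity_inner
  using assms
  by (intro Bochner_Integration.integrable_add[OF adjoint_pairing(1)] integrable_past_inner[of k]
      L2_past_add L2_past_matrix_vector_mult coef_Linf coef_L2 x_L2 u_L2) auto

abbreviation stage_derivative :: "(nat \<Rightarrow> 'a \<Rightarrow> real ^ 'm) \<Rightarrow> nat \<Rightarrow> 'a \<Rightarrow> real" where
  "stage_derivative \<eta> k w \<equiv>
     (coef_Q \<Gamma> k w *v x k w + transpose (coef_L \<Gamma> k w) *v u k w + coef_q \<Gamma> k w) \<bullet> lq_variation \<Gamma> \<eta> k w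
     + (coef_L \<Gamma> k w *v x k w + coef_R \<Gamma> k w *v u k w + coef_rho \<Gamma> k w) \<bullet> \<eta> k w"

lemma integrable_stage_derivative:
  assumes "\<eta> \<in> controls1 \<Gamma>" "k < N"
  shows "integrable \<M> (stage_derivative \<eta> k)"
  using assms
  by (intro Bochner_Integration.integrable_add integrable_past_inner[of k] L2_past_add
      L2_past_matrix_vector_mult Linf_rv_transpose coef_Linf coef_L2 x_L2 u_L2 lq_variation_L2)
    (auto simp: controls_iff)

text \<open>Summation by parts for one stage. The coefficients of \<open>z\<^sub>k\<close> in the conditional mean of
  \<open>\<langle>y\<^sub>k\<^sub>+\<^sub>1, z\<^sub>k\<^sub>+\<^sub>1\<rangle>\<close> are those on the right of the adjoint equation, up to its source terms; the
  coefficients of \<open>\<eta>\<^sub>k\<close> are those of \<open>\<Psi>\<^sub>k\<close>, up to the direct cost of the control.\<close>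

lemma adjoint_duality_step:
  assumes \<eta>: "\<eta> \<in> controls1 \<Gamma>" and k: "k < N"
  shows "(\<integral>w. y (Suc k) w \<bullet> lq_variation \<Gamma> \<eta> (Suc k) w \<partial>\<M>)
    = (\<integral>w. y k w \<bullet> lq_variation \<Gamma> \<eta> k w \<partial>\<M>)
      + (\<integral>w. \<Psi> k w \<bullet> \<eta> k w \<partial>\<M>) - (\<integral>w. stage_derivative \<eta> k w \<partial>\<M>)"
proof -
  let ?z = "lq_variation \<Gamma> \<eta> k"
  let ?f = "\<lambda>w. coef_A \<Gamma> k w *v ?z w + coef_B \<Gamma> k w *v \<eta> k w"
  let ?g = "\<lambda>w. coef_D \<Gamma> k w *v ?z w + coef_E \<Gamma> k w *v \<eta> k w"
  have \<eta>k: "\<eta> k \<in> L2_rv \<M> (past \<Gamma> k)" and z: "?z \<in> L2_rv \<M> (past \<Gamma> k)"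
    using \<eta> k lq_variation_L2 by (auto simp: controls_iff)
  have fg: "?f \<in> L2_rv \<M> (past \<Gamma> k)" "?g \<in> L2_rv \<M> (past \<Gamma> k)"
    using k z \<eta>k by (auto intro!: L2_past_add L2_past_matrix_vector_mult coef_Linf)
  have int_yz: "integrable \<M> (\<lambda>w. y k w \<bullet> ?z w)"
    using k z by (intro integrable_past_inner[of k] y_L2) auto
  have "(\<integral>w. y (Suc k) w \<bullet> lq_variation \<Gamma> \<eta> (Suc k) w \<partial>\<M>)
      = (\<integral>w. y (Suc k) w \<bullet> ?f w + (noise \<Gamma> k w *\<^sub>R y (Suc k) w) \<bullet> ?g w \<partial>\<M>)"
    by (simp add: inner_add_right distrib_left)
  also have "\<dots> = (\<integral>w. adj_mean \<Gamma> y k w \<bullet> ?f w + adj_noise \<Gamma> y k w \<bullet> ?g w \<partial>\<M>)"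
    by (rule adjoint_pairing(2)[OF k fg])
  also have "\<dots> = (\<integral>w. y k w \<bullet> ?z w + \<Psi> k w \<bullet> \<eta> k w - stage_derivative \<eta> k w \<partial>\<M>)"
  proof (rule integral_cong_AE)
    show "(\<lambda>w. adj_mean \<Gamma> y k w \<bullet> ?f w + adj_noise \<Gamma> y k w \<bullet> ?g w) \<in> borel_measurable \<M>"
      by (intro borel_measurable_integrable adjoint_pairing(1) k fg)
    show "(\<lambda>w. y k w \<bullet> ?z w + \<Psi> k w \<bullet> \<eta> k w - stage_derivative \<eta> k w) \<in> borel_measurable \<M>"
      by (intro borel_measurable_integrable Bochner_Integration.integrable_diff
          Bochner_Integration.integrable_add int_yz integrable_stationarity_inner
          integrable_stage_derivative \<eta> k \<eta>k)
    have "AE w in \<M>. y k w = transpose (coef_A \<Gamma> k w) *v adj_mean \<Gamma> y k w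
                   + transpose (coef_D \<Gamma> k w) *v adj_noise \<Gamma> y k w
                   + coef_Q \<Gamma> k w *v x k w + transpose (coef_L \<Gamma> k w) *v u k w + coef_q \<Gamma> k w"
      by (rule eventually_mono[OF adjoint[unfolded adjoint1_def, THEN conjunct2]]) (use k in blast)
    then show "AE w in \<M>. adj_mean \<Gamma> y k w \<bullet> ?f w + adj_noise \<Gamma> y k w \<bullet> ?g w
        = y k w \<bullet> ?z w + \<Psi> k w \<bullet> \<eta> k w - stage_derivative \<eta> k w"
    proof eventually_elim
      case (elim w)
      show ?case
        unfolding stationarity_inner elim
        by (simp only: inner_add_left inner_add_right inner_transpose_matrix)
    qed
  qed
  also have "\<dots> = (\<integral>w. y k w \<bullet> ?z w \<partial>\<M>) + (\<integral>w. \<Psi> k w \<bullet> \<eta> k w \<partial>\<M>)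
      - (\<integral>w. stage_derivative \<eta> k w \<partial>\<M>)"
    using int_yz integrable_stationarity_inner[OF k \<eta>k] integrable_stage_derivative[OF \<eta> k]
    by (simp only: Bochner_Integration.integral_diff Bochner_Integration.integral_add
        Bochner_Integration.integrable_add)
  finally show ?thesis .
qed

text \<open>The derivative of the cost in the direction \<open>\<eta>\<close>, rewritten in terms of \<open>\<eta>\<close> alone: the steps
  telescope from \<open>z\<^sub>0 = 0\<close> to the terminal condition of the adjoint equation.\<close>

lemma adjoint_duality:
  assumes \<eta>: "\<eta> \<in> controls1 \<Gamma>"
  shows "(\<integral>w. (term_G \<Gamma> w *v x N w + term_g \<Gamma> w) \<bullet> lq_variation \<Gamma> \<eta> N w
      + (\<Sum>k<N. stage_derivative \<eta> k w) \<partial>\<M>) = (\<Sum>k<N. \<integral>w. \<Psi> k w \<bullet> \<eta> k w \<partial>\<M>)"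
proof -
  have sum: "(\<integral>w. y j w \<bullet> lq_variation \<Gamma> \<eta> j w \<partial>\<M>)
      = (\<Sum>k<j. (\<integral>w. \<Psi> k w \<bullet> \<eta> k w \<partial>\<M>) - (\<integral>w. stage_derivative \<eta> k w \<partial>\<M>))" if "j \<le> N" for j
    using that
  proof (induction j)
    case (Suc j)
    then show ?case
      using adjoint_duality_step[OF \<eta>, of j] by (simp del: lq_variation.simps)
  qed simp
  have y_int: "integrable \<M> (\<lambda>w. y N w \<bullet> lq_variation \<Gamma> \<eta> N w)"
    by (intro integrable_past_inner[of N] y_L2 lq_variation_L2 \<eta>) auto
  have term_int: "integrable \<M> (\<lambda>w. (term_G \<Gamma> w *v x N w + term_g \<Gamma> w) \<bullet> lq_variation \<Gamma> \<eta> N w)"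
    by (intro integrable_past_inner[of N] L2_past_add L2_past_matrix_vector_mult terminal_coef
        x_L2 lq_variation_L2 \<eta>) auto
  have stage_int: "integrable \<M> (stage_derivative \<eta> k)" if "k \<in> {..<N}" for k
    using integrable_stage_derivative[OF \<eta>] that by blast
  have "(\<integral>w. (term_G \<Gamma> w *v x N w + term_g \<Gamma> w) \<bullet> lq_variation \<Gamma> \<eta> N w \<partial>\<M>)
      = (\<integral>w. y N w \<bullet> lq_variation \<Gamma> \<eta> N w \<partial>\<M>)"
  proof (rule integral_cong_AE)
    show "AE w in \<M>. (term_G \<Gamma> w *v x N w + term_g \<Gamma> w) \<bullet> lq_variation \<Gamma> \<eta> N w
        = y N w \<bullet> lq_variation \<Gamma> \<eta> N w"
      using adjoint[unfolded adjoint1_def, THEN conjunct2] by eventually_elim simp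
  qed (use y_int term_int in auto)
  moreover
  have "(\<integral>w. (term_G \<Gamma> w *v x N w + term_g \<Gamma> w) \<bullet> lq_variation \<Gamma> \<eta> N w
      + (\<Sum>k<N. stage_derivative \<eta> k w) \<partial>\<M>)
    = (\<integral>w. (term_G \<Gamma> w *v x N w + term_g \<Gamma> w) \<bullet> lq_variation \<Gamma> \<eta> N w \<partial>\<M>)
      + (\<Sum>k<N. \<integral>w. stage_derivative \<eta> k w \<partial>\<M>)"
    by (subst Bochner_Integration.integral_add[OF term_int Bochner_Integration.integrable_sum[OF stage_int]],
        assumption, subst Bochner_Integration.integral_sum[OF stage_int]) simp_all
  ultimately show ?thesis
    using sum[of N] by (simp only: sum_subtractf order.refl diff_add_cancel)
qed

abbreviation second_variation :: "(nat \<Rightarrow> 'a \<Rightarrow> real ^ 'm) \<Rightarrow> 'a \<Rightarrow> real" where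
  "second_variation \<eta> w \<equiv>
     (term_G \<Gamma> w *v lq_variation \<Gamma> \<eta> N w) \<bullet> lq_variation \<Gamma> \<eta> N w
     + (\<Sum>k<N. (coef_Q \<Gamma> k w *v lq_variation \<Gamma> \<eta> k w) \<bullet> lq_variation \<Gamma> \<eta> k w
          + 2 * ((transpose (coef_L \<Gamma> k w) *v \<eta> k w) \<bullet> lq_variation \<Gamma> \<eta> k w)
          + (coef_R \<Gamma> k w *v \<eta> k w) \<bullet> \<eta> k w)"

lemma integral_combination:
  fixes c d s :: "'b \<Rightarrow> real"
  assumes "integrable M c" "integrable M d" "integrable M s"
  shows "integrable M (\<lambda>w. c w + a * d w + b * s w)"
    and "(\<integral>w. c w + a * d w + b * s w \<partial>M) = (\<integral>w. c w \<partial>M) + a * (\<integral>w. d w \<partial>M) + b * (\<integral>w. s w \<partial>M)"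
  using assms by simp_all

lemma cost1_expansion:
  assumes \<eta>: "\<eta> \<in> controls1 \<Gamma>"
  shows "cost1 \<Gamma> \<xi> (\<lambda>k w. u k w + e *\<^sub>R \<eta> k w) v
    = cost1 \<Gamma> \<xi> u v + e * (\<Sum>k<N. \<integral>w. \<Psi> k w \<bullet> \<eta> k w \<partial>\<M>)
      + e\<^sup>2 * (1 / 2 * (\<integral>w. second_variation \<eta> w \<partial>\<M>))"
proof -
  let ?z = "lq_variation \<Gamma> \<eta>"
  let ?u = "\<lambda>k w. u k w + e *\<^sub>R \<eta> k w"
  let ?x = "lq_state \<Gamma> \<xi> ?u v"
  let ?c = "\<lambda>x u w. (term_G \<Gamma> w *v x N w) \<bullet> x N w + 2 * (term_g \<Gamma> w \<bullet> x N w)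
       + (\<Sum>k<N. (coef_Q \<Gamma> k w *v x k w) \<bullet> x k w
            + 2 * ((transpose (coef_L \<Gamma> k w) *v u k w) \<bullet> x k w)
            + (coef_R \<Gamma> k w *v u k w) \<bullet> u k w
            + 2 * (coef_q \<Gamma> k w \<bullet> x k w) + 2 * (coef_rho \<Gamma> k w \<bullet> u k w))"
  let ?d = "\<lambda>w. (term_G \<Gamma> w *v x N w + term_g \<Gamma> w) \<bullet> ?z N w + (\<Sum>k<N. stage_derivative \<eta> k w)"
  let ?s = "second_variation \<eta>"
  have int_c: "integrable \<M> (?c X U)"
    if "\<And>k. k \<le> N \<Longrightarrow> X k \<in> L2_rv \<M> (past \<Gamma> k)" "\<And>k. k < N \<Longrightarrow> U k \<in> L2_rv \<M> (past \<Gamma> k)" for X U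
  proof (intro Bochner_Integration.integrable_add Bochner_Integration.integrable_sum
      Bochner_Integration.integrable_mult_right)
    show "integrable \<M> (\<lambda>w. (term_G \<Gamma> w *v X N w) \<bullet> X N w)" "integrable \<M> (\<lambda>w. term_g \<Gamma> w \<bullet> X N w)"
      by (auto intro!: integrable_past_inner[of N] L2_past_matrix_vector_mult terminal_coef that)
  next
    fix k assume "k \<in> {..<N}"
    then have k: "k < N" "k \<le> N" by auto
    show "integrable \<M> (\<lambda>w. (coef_Q \<Gamma> k w *v X k w) \<bullet> X k w)"
      "integrable \<M> (\<lambda>w. (transpose (coef_L \<Gamma> k w) *v U k w) \<bullet> X k w)"
      "integrable \<M> (\<lambda>w. (coef_R \<Gamma> k w *v U k w) \<bullet> U k w)"
      "integrable \<M> (\<lambda>w. coef_q \<Gamma> k w \<bullet> X k w)" "integrable \<M> (\<lambda>w. coef_rho \<Gamma> k w \<bullet> U k w)"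
      using k by (auto simp del: transpose_matrix_vector intro!: integrable_past_inner[of k]
          L2_past_matrix_vector_mult Linf_rv_transpose coef_Linf coef_L2 that)
  qed
  have x': "?x k = (\<lambda>w. x k w + e *\<^sub>R ?z k w)" for k
    by (simp add: fun_eq_iff lq_state_add)
  have u': "?u \<in> controls1 \<Gamma>"
    using u \<eta> unfolding controls_iff by (auto intro!: L2_past_add L2_rv_scaleR)
  have int_c0: "integrable \<M> (?c x u)" and int_c1: "integrable \<M> (?c ?x ?u)"
    by (intro int_c lq_state_L2 u u' v; use u u' in \<open>auto simp: controls_iff\<close>)+
  have int_d: "integrable \<M> ?d"
    by (intro Bochner_Integration.integrable_add Bochner_Integration.integrable_sum
        integrable_stage_derivative \<eta> integrable_past_inner[of N] L2_past_add
        L2_past_matrix_vector_mult terminal_coef x_L2 lq_variation_L2) auto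
  have int_s: "integrable \<M> ?s"
  proof (intro Bochner_Integration.integrable_add Bochner_Integration.integrable_sum
      Bochner_Integration.integrable_mult_right)
    show "integrable \<M> (\<lambda>w. (term_G \<Gamma> w *v ?z N w) \<bullet> ?z N w)"
      by (auto intro!: integrable_past_inner[of N] L2_past_matrix_vector_mult terminal_coef
          lq_variation_L2 \<eta>)
  next
    fix k assume "k \<in> {..<N}"
    then have k: "k < N" "k \<le> N" and \<eta>k: "\<eta> k \<in> L2_rv \<M> (past \<Gamma> k)"
      using \<eta> by (auto simp: controls_iff)
    show "integrable \<M> (\<lambda>w. (coef_Q \<Gamma> k w *v ?z k w) \<bullet> ?z k w)"
      "integrable \<M> (\<lambda>w. (transpose (coef_L \<Gamma> k w) *v \<eta> k w) \<bullet> ?z k w)"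
      "integrable \<M> (\<lambda>w. (coef_R \<Gamma> k w *v \<eta> k w) \<bullet> \<eta> k w)"
      using k \<eta>k \<eta> by (auto simp del: transpose_matrix_vector intro!: integrable_past_inner[of k]
          L2_past_matrix_vector_mult Linf_rv_transpose coef_Linf lq_variation_L2)
  qed
  have "(\<integral>w. ?c ?x ?u w \<partial>\<M>) = (\<integral>w. ?c x u w + 2 * e * ?d w + e\<^sup>2 * ?s w \<partial>\<M>)"
  proof (rule integral_cong_AE)
    show "?c ?x ?u \<in> borel_measurable \<M>"
      using int_c1 by (rule borel_measurable_integrable)
    show "(\<lambda>w. ?c x u w + 2 * e * ?d w + e\<^sup>2 * ?s w) \<in> borel_measurable \<M>"
      by (rule borel_measurable_integrable[OF integral_combination(1)[OF int_c0 int_d int_s]])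
    show "AE w in \<M>. ?c ?x ?u w = ?c x u w + 2 * e * ?d w + e\<^sup>2 * ?s w"
      using coef_symmetric
    proof eventually_elim
      case (elim w)
      have "(\<Sum>k<N. (coef_Q \<Gamma> k w *v ?x k w) \<bullet> ?x k w
            + 2 * ((transpose (coef_L \<Gamma> k w) *v ?u k w) \<bullet> ?x k w)
            + (coef_R \<Gamma> k w *v ?u k w) \<bullet> ?u k w
            + 2 * (coef_q \<Gamma> k w \<bullet> ?x k w) + 2 * (coef_rho \<Gamma> k w \<bullet> ?u k w))
        = (\<Sum>k<N. ((coef_Q \<Gamma> k w *v x k w) \<bullet> x k w
            + 2 * ((transpose (coef_L \<Gamma> k w) *v u k w) \<bullet> x k w)
            + (coef_R \<Gamma> k w *v u k w) \<bullet> u k w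
            + 2 * (coef_q \<Gamma> k w \<bullet> x k w) + 2 * (coef_rho \<Gamma> k w \<bullet> u k w))
          + 2 * e * stage_derivative \<eta> k w
          + e\<^sup>2 * ((coef_Q \<Gamma> k w *v ?z k w) \<bullet> ?z k w
            + 2 * ((transpose (coef_L \<Gamma> k w) *v \<eta> k w) \<bullet> ?z k w) + (coef_R \<Gamma> k w *v \<eta> k w) \<bullet> \<eta> k w))"
        unfolding x' using elim by (intro sum.cong refl stage_cost_add) auto
      moreover have "(term_G \<Gamma> w *v ?x N w) \<bullet> ?x N w + 2 * (term_g \<Gamma> w \<bullet> ?x N w)
        = (term_G \<Gamma> w *v x N w) \<bullet> x N w + 2 * (term_g \<Gamma> w \<bullet> x N w)
          + 2 * e * ((term_G \<Gamma> w *v x N w + term_g \<Gamma> w) \<bullet> ?z N w)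
          + e\<^sup>2 * ((term_G \<Gamma> w *v ?z N w) \<bullet> ?z N w)"
        unfolding x' quadratic_form_add[OF elim[THEN conjunct1]]
        by (simp add: inner_add_left inner_add_right algebra_simps)
      ultimately show ?case
        by (simp only: sum.distrib sum_distrib_left[symmetric] distrib_left)
    qed
  qed
  also have "\<dots> = (\<integral>w. ?c x u w \<partial>\<M>) + 2 * e * (\<integral>w. ?d w \<partial>\<M>) + e\<^sup>2 * (\<integral>w. ?s w \<partial>\<M>)"
    by (rule integral_combination(2)[OF int_c0 int_d int_s])
  finally show ?thesis
    unfolding cost1_def Let_def adjoint_duality[OF \<eta>] by (simp add: algebra_simps del: transpose_matrix_vector)
qed


section \<open>Optimality and stationarity for Player 1\<close>

text \<open>For necessity perturb at a single stage in both directions: then the linear coefficient of the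
  cost must vanish. For sufficiency the expansion at \<open>\<epsilon> = 1\<close> is exact, so only the nonnegative
  quadratic term remains.\<close>

lemma best_response_iff_stationary:
  "(\<forall>u'\<in>controls1 \<Gamma>. cost1 \<Gamma> \<xi> u v \<le> cost1 \<Gamma> \<xi> u' v) \<longleftrightarrow> (\<forall>k<N. AE w in \<M>. \<Psi> k w = 0)"
proof
  assume min: "\<forall>u'\<in>controls1 \<Gamma>. cost1 \<Gamma> \<xi> u v \<le> cost1 \<Gamma> \<xi> u' v"
  show "\<forall>k<N. AE w in \<M>. \<Psi> k w = 0"
  proof (intro allI impI)
    fix k assume k: "k < N"
    show "AE w in \<M>. \<Psi> k w = 0"
    proof (rule AE_zero_if_orthogonal_to_L2[OF subalgebra_past])
      show "k \<le> N" using k by simp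
      show "\<Psi> k \<in> borel_measurable (past \<Gamma> k)"
        using k by (rule borel_measurable_stationarity)
      fix h :: "'a \<Rightarrow> real ^ 'm" assume h: "h \<in> L2_rv \<M> (past \<Gamma> k)"
      show "integrable \<M> (\<lambda>w. \<Psi> k w \<bullet> h w)"
        using k h by (rule integrable_stationarity_inner)
      define \<eta> where "\<eta> j = (if j = k then h else (\<lambda>w. 0))" for j
      have \<eta>: "\<eta> \<in> controls1 \<Gamma>"
        using h by (auto simp: controls_iff \<eta>_def L2_rv_const)
      have "(\<integral>w. \<Psi> j w \<bullet> \<eta> j w \<partial>\<M>) = (if j = k then \<integral>w. \<Psi> k w \<bullet> h w \<partial>\<M> else 0)" for j
        by (simp add: \<eta>_def)
      then have "(\<Sum>j<N. \<integral>w. \<Psi> j w \<bullet> \<eta> j w \<partial>\<M>) = (\<integral>w. \<Psi> k w \<bullet> h w \<partial>\<M>)"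
        using k by simp
      moreover have "(\<lambda>k w. u k w + e *\<^sub>R \<eta> k w) \<in> controls1 \<Gamma>" for e
        using u \<eta> unfolding controls_iff by (auto intro!: L2_past_add L2_rv_scaleR)
      then have "cost1 \<Gamma> \<xi> u v \<le> cost1 \<Gamma> \<xi> (\<lambda>k w. u k w + e *\<^sub>R \<eta> k w) v" for e
        using min by blast
      ultimately have "0 \<le> e * (\<integral>w. \<Psi> k w \<bullet> h w \<partial>\<M>)
          + e\<^sup>2 * (1 / 2 * (\<integral>w. second_variation \<eta> w \<partial>\<M>))" for e
        unfolding cost1_expansion[OF \<eta>] by (simp only: add.assoc le_add_same_cancel1)
      then show "(\<integral>w. \<Psi> k w \<bullet> h w \<partial>\<M>) = 0"
        by (rule linear_coeff_zero_if_quadratic_nonneg)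
    qed
  qed
next
  assume stationary: "\<forall>k<N. AE w in \<M>. \<Psi> k w = 0"
  show "\<forall>u'\<in>controls1 \<Gamma>. cost1 \<Gamma> \<xi> u v \<le> cost1 \<Gamma> \<xi> u' v"
  proof
    fix u' assume u': "u' \<in> controls1 \<Gamma>"
    define \<eta> where "\<eta> k w = u' k w - u k w" for k w
    have \<eta>: "\<eta> \<in> controls1 \<Gamma>"
      using u u' unfolding controls_iff \<eta>_def by (auto intro!: L2_rv_diff subalgebra_past)
    have "(\<integral>w. \<Psi> k w \<bullet> \<eta> k w \<partial>\<M>) = 0" if "k < N" for k
    proof (rule integral_eq_zero_AE)
      have "AE w in \<M>. \<Psi> k w = 0" using stationary that by blast
      then show "AE w in \<M>. \<Psi> k w \<bullet> \<eta> k w = 0" by eventually_elim simp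
    qed
    moreover have "(\<lambda>k w. u k w + 1 *\<^sub>R \<eta> k w) = u'"
      by (simp add: \<eta>_def)
    moreover have "0 \<le> (\<integral>w. second_variation \<eta> w \<partial>\<M>)"
      by (rule second_variation_nonneg)
    ultimately show "cost1 \<Gamma> \<xi> u v \<le> cost1 \<Gamma> \<xi> u' v"
      using cost1_expansion[OF \<eta>, of 1] by simp
  qed
qed

lemma hamiltonian1_AE:
  assumes k: "k < N" and r: "r \<in> L2_rv \<M> (past \<Gamma> k)"
  shows "AE w in \<M>. hamiltonian1 \<Gamma> k (x k) r (v k) y w
    = adj_mean \<Gamma> y k w \<bullet> (coef_A \<Gamma> k w *v x k w + coef_B \<Gamma> k w *v r w + coef_C \<Gamma> k w *v v k w)
      + adj_noise \<Gamma> y k w \<bullet> (coef_D \<Gamma> k w *v x k w + coef_E \<Gamma> k w *v r w + coef_F \<Gamma> k w *v v k w)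
      + 1/2 * ((coef_Q \<Gamma> k w *v x k w) \<bullet> x k w) + 1/2 * ((coef_R \<Gamma> k w *v r w) \<bullet> r w)
      + r w \<bullet> (coef_L \<Gamma> k w *v x k w) + coef_q \<Gamma> k w \<bullet> x k w + coef_rho \<Gamma> k w \<bullet> r w"
proof -
  have "(\<lambda>w. coef_A \<Gamma> k w *v x k w + coef_B \<Gamma> k w *v r w + coef_C \<Gamma> k w *v v k w) \<in> L2_rv \<M> (past \<Gamma> k)"
    "(\<lambda>w. coef_D \<Gamma> k w *v x k w + coef_E \<Gamma> k w *v r w + coef_F \<Gamma> k w *v v k w) \<in> L2_rv \<M> (past \<Gamma> k)"
    using k r by (auto intro!: L2_past_add L2_past_matrix_vector_mult coef_Linf x_L2 v_L2)
  from adjoint_pairing(3)[OF k this] show ?thesis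
    unfolding hamiltonian1_def by eventually_elim (simp only: inner_transpose_matrix)
qed

text \<open>After the conditional expectation has been pulled onto the adjoint process, the Hamiltonian is a
  quadratic polynomial in the control; the symmetry of \<open>R\<^sub>k\<close> makes \<open>\<Psi>\<^sub>k\<close> its derivative.\<close>

lemma hamiltonian1_difference_quotient:
  assumes k: "k < N" and h: "h \<in> L2_rv \<M> (past \<Gamma> k)" and e: "e \<noteq> 0"
  shows "AE w in \<M>. (hamiltonian1 \<Gamma> k (x k) (\<lambda>w. u k w + e *\<^sub>R h w) (v k) y w
      - hamiltonian1 \<Gamma> k (x k) (u k) (v k) y w) / e
    = \<Psi> k w \<bullet> h w + e * (1/2 * ((coef_R \<Gamma> k w *v h w) \<bullet> h w))"
proof -
  have "(\<lambda>w. u k w + e *\<^sub>R h w) \<in> L2_rv \<M> (past \<Gamma> k)"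
    using k h by (intro L2_past_add L2_rv_scaleR u_L2) auto
  from hamiltonian1_AE[OF k this] hamiltonian1_AE[OF k u_L2[OF k]] coef_symmetric
  show ?thesis
  proof eventually_elim
    case (elim w)
    from elim(3) k have "transpose (coef_R \<Gamma> k w) = coef_R \<Gamma> k w" by blast
    note R = quadratic_form_add[OF this]
    have "hamiltonian1 \<Gamma> k (x k) (\<lambda>w. u k w + e *\<^sub>R h w) (v k) y w
      - hamiltonian1 \<Gamma> k (x k) (u k) (v k) y w
      = e * (\<Psi> k w \<bullet> h w + e * (1/2 * ((coef_R \<Gamma> k w *v h w) \<bullet> h w)))"
      unfolding elim(1,2) R stationarity_inner
      by (simp add: matrix_vector_right_distrib matrix_vector_mult_scaleR inner_add_left inner_add_right
          inner_commute[of "h w"] power2_eq_square algebra_simps)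
    then show ?case using e by simp
  qed
qed

lemma partial_u_H1_zero_iff:
  assumes k: "k < N"
  shows "partial_u_H1 \<Gamma> k x u v y (\<lambda>w. 0) \<longleftrightarrow> (AE w in \<M>. \<Psi> k w = 0)"
proof -
  have "((\<lambda>e::real. \<integral>\<^sup>+ w. ennreal \<bar>(hamiltonian1 \<Gamma> k (x k) (\<lambda>w. u k w + e *\<^sub>R h w) (v k) y w
        - hamiltonian1 \<Gamma> k (x k) (u k) (v k) y w) / e - 0 \<bullet> h w\<bar> \<partial>\<M>) \<longlongrightarrow> 0) (at 0)
      \<longleftrightarrow> (AE w in \<M>. \<Psi> k w \<bullet> h w = 0)" (is "(?q \<longlongrightarrow> 0) _ \<longleftrightarrow> _")
    if h: "h \<in> L2_rv \<M> (past \<Gamma> k)" for h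
  proof -
    let ?R = "\<lambda>w. 1/2 * ((coef_R \<Gamma> k w *v h w) \<bullet> h w)"
    have R: "integrable \<M> ?R"
      using k h by (intro Bochner_Integration.integrable_mult_right integrable_past_inner[of k]
          L2_past_matrix_vector_mult coef_Linf) auto
    have "?q e = (\<integral>\<^sup>+ w. ennreal \<bar>\<Psi> k w \<bullet> h w + e * ?R w\<bar> \<partial>\<M>)" if "e \<noteq> 0" for e
    proof (rule nn_integral_cong_AE)
      from hamiltonian1_difference_quotient[OF k h that]
      show "AE w in \<M>. ennreal \<bar>(hamiltonian1 \<Gamma> k (x k) (\<lambda>w. u k w + e *\<^sub>R h w) (v k) y w
          - hamiltonian1 \<Gamma> k (x k) (u k) (v k) y w) / e - 0 \<bullet> h w\<bar>
        = ennreal \<bar>\<Psi> k w \<bullet> h w + e * ?R w\<bar>"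
        by eventually_elim (simp only: inner_zero_left diff_zero)
    qed
    then have "(?q \<longlongrightarrow> 0) (at 0)
        \<longleftrightarrow> ((\<lambda>e. \<integral>\<^sup>+ w. ennreal \<bar>\<Psi> k w \<bullet> h w + e * ?R w\<bar> \<partial>\<M>) \<longlongrightarrow> 0) (at 0)"
      by (intro tendsto_cong) (auto simp: eventually_at_filter)
    then show ?thesis
      by (simp only: nn_integral_affine_tendsto_0_iff[OF integrable_stationarity_inner[OF k h] R])
  qed
  moreover have "(\<lambda>w. 0) \<in> L2_rv \<M> (past \<Gamma> k)"
    by (rule L2_rv_const)
  ultimately have "partial_u_H1 \<Gamma> k x u v y (\<lambda>w. 0)
      \<longleftrightarrow> (\<forall>h\<in>L2_rv \<M> (past \<Gamma> k). AE w in \<M>. \<Psi> k w \<bullet> h w = 0)"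
    unfolding partial_u_H1_def has_rv_gradient_def by blast
  also have "\<dots> \<longleftrightarrow> (AE w in \<M>. \<Psi> k w = 0)"
  proof
    assume orth: "\<forall>h\<in>L2_rv \<M> (past \<Gamma> k). AE w in \<M>. \<Psi> k w \<bullet> h w = 0"
    show "AE w in \<M>. \<Psi> k w = 0"
    proof (rule AE_zero_if_orthogonal_to_L2[OF subalgebra_past])
      fix h :: "'a \<Rightarrow> real ^ 'm" assume h: "h \<in> L2_rv \<M> (past \<Gamma> k)"
      show "integrable \<M> (\<lambda>w. \<Psi> k w \<bullet> h w)"
        using k h by (rule integrable_stationarity_inner)
      show "(\<integral>w. \<Psi> k w \<bullet> h w \<partial>\<M>) = 0"
        using orth h by (intro integral_eq_zero_AE) blast
    qed (use k borel_measurable_stationarity in auto)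
  qed (auto elim!: eventually_mono)
  finally show ?thesis .
qed

end


section \<open>Exchanging the players\<close>

text \<open>Everything proved for Player 1 in this game is a statement on Player 2 in \<open>\<Gamma>\<close>.\<close>

definition swap_players ::
  "('a, 'n::finite, 'm::finite, 'l::finite) lq_game \<Rightarrow> ('a, 'n, 'l, 'm) lq_game" where
  "swap_players \<Gamma> =
     \<lparr>pspace = pspace \<Gamma>, horizon = horizon \<Gamma>, noise = noise \<Gamma>,
      coef_A = coef_A \<Gamma>, coef_B = coef_C \<Gamma>, coef_C = coef_B \<Gamma>, coef_b = coef_b \<Gamma>,
      coef_D = coef_D \<Gamma>, coef_E = coef_F \<Gamma>, coef_F = coef_E \<Gamma>, coef_sigma = coef_sigma \<Gamma>,
      coef_Q = coef_P \<Gamma>, coef_L = coef_M \<Gamma>, coef_R = coef_S \<Gamma>, coef_q = coef_p \<Gamma>,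
      coef_rho = coef_theta \<Gamma>, term_G = term_H \<Gamma>, term_g = term_h \<Gamma>,
      coef_P = coef_Q \<Gamma>, coef_M = coef_L \<Gamma>, coef_S = coef_R \<Gamma>, coef_p = coef_q \<Gamma>,
      coef_theta = coef_rho \<Gamma>, term_H = term_G \<Gamma>, term_h = term_g \<Gamma>\<rparr>"

lemma swap_players_simps [simp]:
  "pspace (swap_players \<Gamma>) = pspace \<Gamma>" "horizon (swap_players \<Gamma>) = horizon \<Gamma>"
  "noise (swap_players \<Gamma>) = noise \<Gamma>"
  "coef_A (swap_players \<Gamma>) = coef_A \<Gamma>" "coef_B (swap_players \<Gamma>) = coef_C \<Gamma>"
  "coef_C (swap_players \<Gamma>) = coef_B \<Gamma>" "coef_b (swap_players \<Gamma>) = coef_b \<Gamma>"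
  "coef_D (swap_players \<Gamma>) = coef_D \<Gamma>" "coef_E (swap_players \<Gamma>) = coef_F \<Gamma>"
  "coef_F (swap_players \<Gamma>) = coef_E \<Gamma>" "coef_sigma (swap_players \<Gamma>) = coef_sigma \<Gamma>"
  "coef_Q (swap_players \<Gamma>) = coef_P \<Gamma>" "coef_L (swap_players \<Gamma>) = coef_M \<Gamma>"
  "coef_R (swap_players \<Gamma>) = coef_S \<Gamma>" "coef_q (swap_players \<Gamma>) = coef_p \<Gamma>"
  "coef_rho (swap_players \<Gamma>) = coef_theta \<Gamma>" "term_G (swap_players \<Gamma>) = term_H \<Gamma>"
  "term_g (swap_players \<Gamma>) = term_h \<Gamma>" "coef_P (swap_players \<Gamma>) = coef_Q \<Gamma>"
  "coef_M (swap_players \<Gamma>) = coef_L \<Gamma>" "coef_S (swap_players \<Gamma>) = coef_R \<Gamma>"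
  "coef_p (swap_players \<Gamma>) = coef_q \<Gamma>" "coef_theta (swap_players \<Gamma>) = coef_rho \<Gamma>"
  "term_H (swap_players \<Gamma>) = term_G \<Gamma>" "term_h (swap_players \<Gamma>) = term_g \<Gamma>"
  by (simp_all add: swap_players_def)

lemma past_swap [simp]: "past (swap_players \<Gamma>) = past \<Gamma>"
  by (simp add: past_def fun_eq_iff)

lemma proc_swap [simp]:
  "L2_proc (swap_players \<Gamma>) I = L2_proc \<Gamma> I" "Linf_proc (swap_players \<Gamma>) I = Linf_proc \<Gamma> I"
  unfolding L2_proc_def Linf_proc_def swap_players_simps past_swap by (rule refl)+

lemma adj_swap [simp]:
  "adj_mean (swap_players \<Gamma>) = adj_mean \<Gamma>" "adj_noise (swap_players \<Gamma>) = adj_noise \<Gamma>"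
  by (simp_all add: adj_mean_def adj_noise_def fun_eq_iff)

lemma lq_state_swap: "lq_state (swap_players \<Gamma>) \<xi> v u = lq_state \<Gamma> \<xi> u v"
proof
  fix k show "lq_state (swap_players \<Gamma>) \<xi> v u k = lq_state \<Gamma> \<xi> u v k"
    by (induction k) (simp_all add: fun_eq_iff add_ac)
qed

lemma lq_standing_swap:
  assumes "lq_standing \<Gamma>"
  shows "lq_standing (swap_players \<Gamma>)"
proof
  show "noise_assumptions (swap_players \<Gamma>)"
    using assms unfolding lq_standing_def noise_assumptions_def swap_players_simps past_swap by blast
  show "coefficient_assumptions (swap_players \<Gamma>)"
    using assms unfolding lq_standing_def coefficient_assumptions_def swap_players_simps past_swap proc_swap
    by blast
  show "convexity_assumptions (swap_players \<Gamma>)"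
  proof -
    have convex: "convexity_assumptions \<Gamma>"
      using assms by (simp add: lq_standing_def)
    obtain d where "d > 0" and psd: "AE w in pspace \<Gamma>. psd (term_G \<Gamma> w) \<and> psd (term_H \<Gamma> w) \<and>
        (\<forall>k\<in>stages \<Gamma>.
           psd (coef_R \<Gamma> k w - mat d) \<and> psd (coef_S \<Gamma> k w - mat d) \<and>
           psd (coef_Q \<Gamma> k w
                - transpose (coef_L \<Gamma> k w) ** matrix_inv (coef_R \<Gamma> k w) ** coef_L \<Gamma> k w) \<and>
           psd (coef_P \<Gamma> k w
                - transpose (coef_M \<Gamma> k w) ** matrix_inv (coef_S \<Gamma> k w) ** coef_M \<Gamma> k w))"
      using convex unfolding convexity_assumptions_def by blast
    show ?thesis
      unfolding convexity_assumptions_def swap_players_simps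
    proof (intro conjI exI[of _ d] \<open>d > 0\<close>)
    qed (rule eventually_mono[OF convex[unfolded convexity_assumptions_def, THEN conjunct1]]
        eventually_mono[OF psd]; blast)+
  qed
qed

lemma cost1_swap: "cost1 (swap_players \<Gamma>) \<xi> v u = cost2 \<Gamma> \<xi> u v"
  unfolding cost1_def cost2_def swap_players_simps lq_state_swap by (rule refl)

lemma adjoint1_swap: "adjoint1 (swap_players \<Gamma>) x v y \<longleftrightarrow> adjoint2 \<Gamma> x v y"
  unfolding adjoint1_def adjoint2_def swap_players_simps proc_swap adj_swap by (rule refl)

lemma hamiltonian1_swap:
  fixes \<Gamma> :: "('a, 'n::finite, 'm::finite, 'l::finite) lq_game"
  shows "hamiltonian1 (swap_players \<Gamma>) k x v u y = hamiltonian2 \<Gamma> k x u v y"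
proof -
  have "a + c + b = a + b + c" for a b c :: "real ^ 'n"
    by (simp add: add_ac)
  note swap = this[of _ "coef_C \<Gamma> k _ *v _" "coef_B \<Gamma> k _ *v _"]
    this[of _ "coef_F \<Gamma> k _ *v _" "coef_E \<Gamma> k _ *v _"]
  show ?thesis
    unfolding hamiltonian1_def hamiltonian2_def swap_players_simps past_swap swap by (rule refl)
qed

lemma partial_u_H1_swap:
  "partial_u_H1 (swap_players \<Gamma>) k x v u y Z \<longleftrightarrow> partial_v_H2 \<Gamma> k x u v y Z"
  unfolding partial_u_H1_def partial_v_H2_def swap_players_simps past_swap hamiltonian1_swap
  by (rule refl)

lemma open_loop_nash_iff:
  assumes "u \<in> controls1 \<Gamma>" "v \<in> controls2 \<Gamma>"
  shows "open_loop_nash \<Gamma> \<xi> u v \<longleftrightarrow>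
    (\<forall>u'\<in>controls1 \<Gamma>. cost1 \<Gamma> \<xi> u v \<le> cost1 \<Gamma> \<xi> u' v)
    \<and> (\<forall>v'\<in>controls2 \<Gamma>. cost2 \<Gamma> \<xi> u v \<le> cost2 \<Gamma> \<xi> u v')"
proof -
  have "ereal (f a) = (INF b\<in>A. ereal (f b)) \<longleftrightarrow> (\<forall>b\<in>A. f a \<le> f b)" if "a \<in> A"
    for f :: "'z \<Rightarrow> real" and a A
  proof
    assume "ereal (f a) = (INF b\<in>A. ereal (f b))"
    then show "\<forall>b\<in>A. f a \<le> f b"
      by (metis INF_lower ereal_less_eq(3))
  next
    assume "\<forall>b\<in>A. f a \<le> f b"
    then show "ereal (f a) = (INF b\<in>A. ereal (f b))"
      using that by (intro antisym INF_greatest INF_lower) auto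
  qed
  from this[of u "controls1 \<Gamma>" "\<lambda>u. cost1 \<Gamma> \<xi> u v"] this[of v "controls2 \<Gamma>" "cost2 \<Gamma> \<xi> u"] assms
  show ?thesis
    by (simp add: open_loop_nash_def)
qed

theorem theorem4p1:
  fixes \<Gamma> :: "('a, 'n::finite, 'm::finite, 'l::finite) lq_game"
    and \<xi> :: "real ^ 'n"
    and u :: "nat \<Rightarrow> 'a \<Rightarrow> real ^ 'm"
    and v :: "nat \<Rightarrow> 'a \<Rightarrow> real ^ 'l"
    and x y1 y2 :: "nat \<Rightarrow> 'a \<Rightarrow> real ^ 'n"
  assumes "noise_assumptions \<Gamma>"
    and "coefficient_assumptions \<Gamma>"
    and "convexity_assumptions \<Gamma>"
    and "u \<in> controls1 \<Gamma>" and "v \<in> controls2 \<Gamma>"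
    and "x = lq_state \<Gamma> \<xi> u v"
    and "adjoint1 \<Gamma> x u y1" and "adjoint2 \<Gamma> x v y2"
  shows "(open_loop_nash \<Gamma> \<xi> u v \<longleftrightarrow>
            (\<forall>k<horizon \<Gamma>. partial_u_H1 \<Gamma> k x u v y1 (\<lambda>w. 0) \<and>
                           partial_v_H2 \<Gamma> k x u v y2 (\<lambda>w. 0))) \<and>
         ((\<forall>k<horizon \<Gamma>. partial_u_H1 \<Gamma> k x u v y1 (\<lambda>w. 0) \<and>
                         partial_v_H2 \<Gamma> k x u v y2 (\<lambda>w. 0)) \<longleftrightarrow>
            (AE w in pspace \<Gamma>. \<forall>k<horizon \<Gamma>.
               transpose (coef_B \<Gamma> k w) *v adj_mean \<Gamma> y1 k w
                 + transpose (coef_E \<Gamma> k w) *v adj_noise \<Gamma> y1 k w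
                 + coef_L \<Gamma> k w *v x k w + coef_R \<Gamma> k w *v u k w + coef_rho \<Gamma> k w = 0 \<and>
               transpose (coef_C \<Gamma> k w) *v adj_mean \<Gamma> y2 k w
                 + transpose (coef_F \<Gamma> k w) *v adj_noise \<Gamma> y2 k w
                 + coef_M \<Gamma> k w *v x k w + coef_S \<Gamma> k w *v v k w + coef_theta \<Gamma> k w = 0))"
proof -
  interpret P1: lq_adjoint \<Gamma> \<xi> u v y1
    using assms by unfold_locales auto
  interpret P2: lq_adjoint "swap_players \<Gamma>" \<xi> v u y2
    using assms lq_standing_swap[OF P1.lq_standing_axioms]
    by (intro lq_adjoint.intro lq_adjoint_axioms.intro)
      (auto simp: controls1_def controls2_def lq_state_swap adjoint1_swap)
  let ?A = "\<lambda>k w. stationarity1 \<Gamma> x u y1 k w = 0"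
  let ?B = "\<lambda>k w. stationarity1 (swap_players \<Gamma>) x v y2 k w = 0"
  have nash: "open_loop_nash \<Gamma> \<xi> u v \<longleftrightarrow>
      (\<forall>k<horizon \<Gamma>. (AE w in pspace \<Gamma>. ?A k w) \<and> (AE w in pspace \<Gamma>. ?B k w))"
    using P1.best_response_iff_stationary P2.best_response_iff_stationary
    unfolding open_loop_nash_iff[OF assms(4,5)] controls1_def controls2_def lq_state_swap
      cost1_swap proc_swap swap_players_simps assms(6)
    by blast
  have gradient: "partial_u_H1 \<Gamma> k x u v y1 (\<lambda>w. 0) \<and> partial_v_H2 \<Gamma> k x u v y2 (\<lambda>w. 0)
      \<longleftrightarrow> (AE w in pspace \<Gamma>. ?A k w) \<and> (AE w in pspace \<Gamma>. ?B k w)" if "k < horizon \<Gamma>" for k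
    using P1.partial_u_H1_zero_iff[of k] P2.partial_u_H1_zero_iff[of k] that assms(6)
    unfolding lq_state_swap partial_u_H1_swap swap_players_simps assms(6) by blast
  have "(\<forall>k<horizon \<Gamma>. (AE w in pspace \<Gamma>. ?A k w) \<and> (AE w in pspace \<Gamma>. ?B k w))
      \<longleftrightarrow> (AE w in pspace \<Gamma>. \<forall>k<horizon \<Gamma>. ?A k w \<and> ?B k w)"
    using AE_finite_all[of "{..<horizon \<Gamma>}" "\<lambda>w k. ?A k w \<and> ?B k w" "ae_filter (pspace \<Gamma>)", OF finite_lessThan]
    unfolding AE_conj_iff by (simp only: Ball_def lessThan_iff)
  with nash gradient show ?thesis
    unfolding stationarity1_def adj_swap swap_players_simps by blast
qed

end
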